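(* Let $n \geq 4$. For all $3 \leq k \leq n$, the reduced homology of the CW complex $C_{n,k}$ is concentrated in degree $k-1$, and is free over $\mathbb{Z}$ in degree $k-1$.
   Context: Let $\mathbf{n} = \{1,\ldots,n\}$. $\Psi^+_n$ is the set of points of $\{\pm1\}^n\subset\mathbb{R}^n$ with an even number of negative coordinates. For $\mathbf{v}\in\Psi^+_n$ and $S\subseteq\mathbf{n}$, $L(\mathbf{v},S)$ is the set of points of $\Psi^+_n$ agreeing with $\mathbf{v}$ in the $i$-th coordinate for every $i\notin S$. $\Pi(V)$ denotes the convex hull of $V$. The half cube is $h\gamma_n = \Pi(\Psi^+_n) = \Pi(L(\mathbf{v},\mathbf{n}))$. It is a regular CW complex whose set of cells $E$ consists of the vertices of $h\gamma_n$, the relative interiors of all $k$-dimensional faces of $h\gamma_n$ for $0<k<n$, and the interior of $h\gamma_n$. For $k\ge 3$, $E(k)\subseteq E$ consists of all cells $e\in E$ except those whose closure is $\Pi(L(\mathbf{v},S))$ for some $\mathbf{v}\in\Psi^+_n$ and some $S\subseteq\mathbf{n}$ with $|S|\ge k$ (the "half cube shaped" faces of dimension at least $k$, including $h\gamma_n$ itself when $k \le n$). For $3\le k\le n$, $C_{n,k}$ is the subcomplex of $h\gamma_n$ with set of cells $E(k)$; its underlying space is $\bigcup_{e\in E(k)} e$. Homology is taken with integer coefficients. *)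

theory Defs
  imports "HOL-Analysis.Analysis" "HOL-Homology.Homology"
begin

definition Psi :: "(real ^ 'n::finite) set" where
  "Psi = {x. (\<forall>i. x $ i = 1 \<or> x $ i = -1) \<and> even (card {i. x $ i < 0})}"

definition L :: "real ^ 'n::finite \<Rightarrow> 'n set \<Rightarrow> (real ^ 'n) set" where
  "L v S = {x \<in> Psi. \<forall>i. i \<notin> S \<longrightarrow> x $ i = v $ i}"

definition half_cube :: "(real ^ 'n::finite) set" where
  "half_cube = convex hull Psi"

definition half_cube_cells :: "(real ^ 'n::finite) set set" where
  "half_cube_cells =
     {{v} | v. v extreme_point_of half_cube}
     \<union> {rel_interior F | F. F face_of half_cube \<and> 0 < aff_dim F \<and> aff_dim F < int CARD('n)}
     \<union> {interior half_cube}"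

text \<open>The cells that remain when all half cube shaped cells of dimension at least \<open>k\<close>
  are removed.\<close>

definition cells_without :: "nat \<Rightarrow> (real ^ 'n::finite) set set" where
  "cells_without k =
     {e \<in> half_cube_cells.
        \<not> (\<exists>v \<in> Psi. \<exists>S. card S \<ge> k \<and> closure e = convex hull (L v S))}"

text \<open>The underlying space of the subcomplex \<open>C\<^sub>n\<^sub>,\<^sub>k\<close>, where \<open>n = CARD('n)\<close>. The complex is finite,
  so its CW topology is the subspace topology.\<close>

definition half_cube_complex :: "nat \<Rightarrow> (real ^ 'n::finite) topology" where
  "half_cube_complex k = top_of_set (\<Union> (cells_without k))"

text \<open>Taking the basis in the type of elements of \<open>G\<close> loses no generality: the basis of a
  free abelian group embeds into the group.\<close>

definition free_abelian :: "('a, 'b) monoid_scheme \<Rightarrow> bool" where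
  "free_abelian G \<longleftrightarrow> comm_group G \<and> (\<exists>B :: 'a set. G \<cong> free_Abelian_group B)"

end

theory Submission
  imports Defs
begin

text \<open>
  Cut off from the cube \<open>[-1, 1]\<^sup>n\<close>, at each vertex \<open>w\<close> with an odd number of negative coordinates
  (an odd vertex), the corner \<open>w \<bullet> x > n - 2\<close>. What remains is the half cube (\<open>half_cube_eq\<close>). Its
  faces are of two kinds: the traces of faces of the cube, which are the half cube shaped ones, and
  the simplices lying in the cutting hyperplanes. Deleting the half cube shaped faces of dimension
  at least \<open>k\<close> therefore leaves the points of the half cube that lie in the \<open>(k-1)\<close>-skeleton of the
  cube or on a cutting hyperplane (\<open>union_cells_without\<close>).

  Let \<open>Y\<close> be the union of the \<open>(k-1)\<close>-skeleton of the cube and all closed corners. Projecting every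
  corner orthogonally onto its cut retracts \<open>Y\<close> onto \<open>C\<^sub>n\<^sub>,\<^sub>k\<close> (\<open>homotopy_equivalent_cut_corners\<close>).
  Expanding the cube away from its centre and clamping the coordinates at \<open>1\<close> and \<open>-1\<close>, by the least
  factor that moves a given point into the \<open>(k-1)\<close>-skeleton, retracts \<open>Y\<close> onto that skeleton
  (\<open>homotopy_equivalent_skeleton\<close>). The expansion is possible at points with fewer than \<open>k\<close> vanishing
  coordinates; a point of a corner has at most two, so \<open>k \<ge> 3\<close> is enough. Both
  retractions are homotopic to the identity along line segments inside \<open>Y\<close>, so \<open>C\<^sub>n\<^sub>,\<^sub>k\<close> has the
  homotopy type of the \<open>(k-1)\<close>-skeleton of the \<open>n\<close>-cube.

  The homology of that skeleton is found by attaching the open cells of the cube one at a time.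
  Attaching a cell of dimension \<open>d\<close> has relative homology \<open>\<int>\<close> in degree \<open>d\<close> and zero elsewhere, by
  excision and the homology of spheres. Hence degrees above the dimension of the skeleton never
  acquire homology; in the top degree the group is built by successive extensions of subgroups of
  \<open>\<int>\<close> and stays free (\<open>finitely_free_extension\<close>); and in the degrees below, nothing is lost when the
  remaining cells are added, which ends with the contractible cube.
\<close>

section \<open>Finitely generated free abelian groups\<close>

text \<open>Bases are taken among the natural numbers so that a finite basis always leaves room for one more
  generator, and so that groups over different types can be compared.\<close>

definition finitely_free :: "('a, 'b) monoid_scheme \<Rightarrow> bool" where
  "finitely_free G \<longleftrightarrow> (\<exists>B :: nat set. finite B \<and> G \<cong> free_Abelian_group B)"

text \<open>An extension of a subgroup of \<open>\<int>\<close> by a finitely generated free group splits: a nonzero image of \<open>f\<close>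
  is generated by its least positive element, and a preimage \<open>g\<close> of that element is one further
  basis element.\<close>

lemma finitely_free_extension:
  fixes B :: "nat set"
  assumes "comm_group G" and "finite B"
    and i: "i \<in> hom (free_Abelian_group B) G" and inj: "inj_on i (carrier (free_Abelian_group B))"
    and f: "f \<in> hom G integer_group"
    and img: "i ` carrier (free_Abelian_group B) = kernel G integer_group f"
  shows "finitely_free G"
proof (cases "\<forall>x \<in> carrier G. f x = 0")
  case True
  then have "i ` carrier (free_Abelian_group B) = carrier G"
    using img by (auto simp: kernel_def)
  then have "i \<in> iso (free_Abelian_group B) G"
    using i inj by (simp add: iso_def bij_betw_def)
  then show ?thesis
    using assms(2) finitely_free_def group.iso_sym is_isoI group_free_Abelian_group by metis
next
  case False
  interpret G: comm_group G by fact
  interpret f: group_hom G integer_group f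
    using f by (simp add: group_hom_def group_hom_axioms_def G.is_group)
  interpret i: group_hom "free_Abelian_group B" G i
    using i by (simp add: group_hom_def group_hom_axioms_def G.is_group)
  have f_inv: "f (inv\<^bsub>G\<^esub> x) = - f x" if "x \<in> carrier G" for x
    using f.hom_inv [OF that] by simp
  have f_pow: "f (x [^]\<^bsub>G\<^esub> (a::int)) = a * f x" if "x \<in> carrier G" for x a
    using f.hom_int_pow [OF that, of a] by simp
  define P where "P m \<longleftrightarrow> 0 < m \<and> (\<exists>g \<in> carrier G. f g = int m)" for m
  have "\<exists>m. P m"
  proof -
    obtain x where x: "x \<in> carrier G" "f x \<noteq> 0" using False by blast
    show ?thesis
    proof (cases "f x > 0")
      case True
      then show ?thesis using x by (intro exI[of _ "nat (f x)"]) (auto simp: P_def)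
    next
      case False
      then show ?thesis using x f_inv[of x]
        by (intro exI[of _ "nat (- f x)"]) (auto simp: P_def intro!: bexI[of _ "inv\<^bsub>G\<^esub> x"])
    qed
  qed
  define m where "m = (LEAST m. P m)"
  have "P m" using \<open>\<exists>m. P m\<close> unfolding m_def by (metis LeastI)
  then obtain g where g: "g \<in> carrier G" "f g = int m" and m: "m > 0"
    by (auto simp: P_def)
  have least: "m \<le> m'" if "P m'" for m' using that by (simp add: m_def Least_le)
  have dvd: "\<exists>q. f x = q * int m" if x: "x \<in> carrier G" for x
  proof -
    define y where "y = x \<otimes>\<^bsub>G\<^esub> g [^]\<^bsub>G\<^esub> (- (f x div int m))"
    have y: "y \<in> carrier G" by (simp add: y_def x g)
    have "f y = f x mod int m"
      by (simp add: y_def x g f_pow minus_div_mult_eq_mod [symmetric])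
    moreover have "f x mod int m = 0"
    proof (rule ccontr)
      assume "f x mod int m \<noteq> 0"
      then have pos: "0 < f x mod int m" using m by (metis of_nat_0_less_iff order_le_less pos_mod_sign)
      have "P (nat (f x mod int m))"
        unfolding P_def using y \<open>f y = _\<close> pos by (intro conjI bexI[of _ y]) auto
      then have "m \<le> nat (f x mod int m)" by (rule least)
      moreover have "f x mod int m < int m" using m by simp
      ultimately show False using pos by linarith
    qed
    ultimately show ?thesis by (metis dvd_def mod_0_imp_dvd mult.commute)
  qed
  obtain b where b: "b \<notin> B" using \<open>finite B\<close> ex_new_if_finite infinite_UNIV_nat by blast
  let ?F = "free_Abelian_group (insert b B)"
  \<comment> \<open>The new number \<open>b\<close> is the index of \<open>g\<close>; \<open>r\<close> deletes the \<open>b\<close>-component of a formal sum.\<close>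
  define r where "r c = c - frag_cmul (Poly_Mapping.lookup c b) (frag_of b)" for c :: "nat \<Rightarrow>\<^sub>0 int"
  have lookup_r: "Poly_Mapping.lookup (r c) a = (if a = b then 0 else Poly_Mapping.lookup c a)" for a c
    by (auto simp: r_def lookup_minus lookup_frag_cmul lookup_frag_of)
  have r: "Poly_Mapping.keys (r c) \<subseteq> B" if "Poly_Mapping.keys c \<subseteq> insert b B" for c
    using that lookup_r[of c] by (auto simp: in_keys_iff split: if_splits)
  have r_id: "r c = c" if "Poly_Mapping.keys c \<subseteq> B" for c
    using that b by (intro poly_mapping_eqI) (auto simp: lookup_r in_keys_iff)
  have r_add: "r (c + d) = r c + r d" for c d
    by (intro poly_mapping_eqI) (simp add: lookup_r lookup_add)
  define h where "h c = i (r c) \<otimes>\<^bsub>G\<^esub> g [^]\<^bsub>G\<^esub> Poly_Mapping.lookup c b" for c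
  have ic: "i c \<in> carrier G" if "Poly_Mapping.keys c \<subseteq> B" for c
    using that i.hom_closed[of c] by simp
  have i_add: "i (c + d) = i c \<otimes>\<^bsub>G\<^esub> i d" if "Poly_Mapping.keys c \<subseteq> B" "Poly_Mapping.keys d \<subseteq> B" for c d
    using that i.hom_mult[of c d] by simp
  have fi: "f (i c) = 0" if "Poly_Mapping.keys c \<subseteq> B" for c
    using that img by (auto simp: kernel_def)
  have h_hom: "h \<in> hom ?F G"
  proof (rule homI)
    fix c d assume cd: "c \<in> carrier ?F" "d \<in> carrier ?F"
    then have rc: "Poly_Mapping.keys (r c) \<subseteq> B" "Poly_Mapping.keys (r d) \<subseteq> B" using r by auto
    show "h (c \<otimes>\<^bsub>?F\<^esub> d) = h c \<otimes>\<^bsub>G\<^esub> h d"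
      using rc g by (simp add: h_def r_add lookup_add i_add G.int_pow_mult [symmetric] ic G.m_ac)
  qed (use r ic g in \<open>auto simp: h_def\<close>)
  have "inj_on h (carrier ?F)"
  proof -
    interpret h: group_hom ?F G h
      using h_hom by (simp add: group_hom_def group_hom_axioms_def G.is_group)
    have "c = 0" if c: "Poly_Mapping.keys c \<subseteq> insert b B" and h1: "h c = \<one>\<^bsub>G\<^esub>" for c
    proof -
      have "f (h c) = 0" using h1 f.hom_one by simp
      then have "Poly_Mapping.lookup c b = 0"
        using r[OF c] g ic m by (simp add: h_def f_pow fi)
      then have "r c = c" by (simp add: r_def)
      then have "i c = \<one>\<^bsub>G\<^esub>" "Poly_Mapping.keys c \<subseteq> B"
        using h1 \<open>Poly_Mapping.lookup c b = 0\<close> r[OF c] ic[of c] by (auto simp: h_def)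
      then show "c = 0"
        using inj i.hom_one by (auto simp: inj_on_def)
    qed
    then show ?thesis
      by (subst h.inj_on_one_iff) auto
  qed
  moreover have "h ` carrier ?F = carrier G"
  proof
    show "h ` carrier ?F \<subseteq> carrier G" using h_hom by (auto simp: hom_def)
    show "carrier G \<subseteq> h ` carrier ?F"
    proof
      fix x assume x: "x \<in> carrier G"
      obtain q where q: "f x = q * int m" using dvd[OF x] by blast
      define y where "y = x \<otimes>\<^bsub>G\<^esub> g [^]\<^bsub>G\<^esub> (- q)"
      have y: "y \<in> carrier G" "f y = 0" using x g q by (simp_all add: y_def f_pow)
      then have "y \<in> i ` carrier (free_Abelian_group B)" unfolding img by (simp add: kernel_def)
      then obtain c where c: "Poly_Mapping.keys c \<subseteq> B" "y = i c" by auto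
      define d where "d = c + frag_cmul q (frag_of b)"
      have "Poly_Mapping.lookup c b = 0" using c(1) b by (auto simp: in_keys_iff)
      then have ld: "Poly_Mapping.lookup d b = q" by (simp add: d_def lookup_add lookup_frag_cmul lookup_frag_of)
      have "r d = c" unfolding r_def ld by (simp add: d_def)
      have "h d = y \<otimes>\<^bsub>G\<^esub> g [^]\<^bsub>G\<^esub> q" by (simp add: h_def ld \<open>r d = c\<close> c)
      also have "\<dots> = x"
        using x g by (simp add: y_def G.m_assoc G.int_pow_neg)
      finally have "h d = x" .
      moreover have "d \<in> carrier ?F"
        unfolding d_def using c(1) keys_add[of c "frag_cmul q (frag_of b)"] keys_cmul[of q "frag_of b"]
        by (auto; fastforce)
      ultimately show "x \<in> h ` carrier ?F" by blast
    qed
  qed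
  ultimately have "h \<in> iso ?F G" using h_hom by (simp add: iso_def bij_betw_def)
  then have "G \<cong> ?F" by (metis is_isoI group.iso_sym group_free_Abelian_group)
  then show ?thesis using \<open>finite B\<close> unfolding finitely_free_def by (intro exI[of _ "insert b B"]) simp
qed

text \<open>The isomorphism itself moves the basis from \<open>\<nat>\<close> into the type of elements of \<open>G\<close>.\<close>

lemma free_abelian_of_finitely_free:
  assumes "comm_group G" "finitely_free G"
  shows "free_abelian G"
proof -
  obtain B :: "nat set" where "G \<cong> free_Abelian_group B"
    using assms(2) by (auto simp: finitely_free_def)
  then have "free_Abelian_group B \<cong> G"
    by (simp add: assms(1) comm_group.axioms(2) group.iso_sym)
  then obtain j where j: "j \<in> iso (free_Abelian_group B) G" by (auto simp: is_iso_def)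
  have "inj_on (\<lambda>b. j (frag_of b)) B"
  proof (rule inj_onI)
    fix x y assume xy: "x \<in> B" "y \<in> B" "j (frag_of x) = j (frag_of y)"
    have "inj_on j (carrier (free_Abelian_group B))" using j by (simp add: iso_def bij_betw_def)
    from inj_onD [OF this xy(3)] xy(1,2) show "x = y" by (simp add: frag_of_eq)
  qed
  then have "B \<approx> (\<lambda>b. j (frag_of b)) ` B"
    by (metis bij_betw_imageI eqpoll_def)
  then have "G \<cong> free_Abelian_group ((\<lambda>b. j (frag_of b)) ` B)"
    using \<open>G \<cong> free_Abelian_group B\<close> isomorphic_free_Abelian_groups iso_trans by blast
  then show ?thesis using assms(1) unfolding free_abelian_def by blast
qed

lemma finitely_free_iso:
  assumes "finitely_free G" "H \<cong> G" shows "finitely_free H"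
  using assms unfolding finitely_free_def by (blast intro: iso_trans)

lemma finitely_free_trivial:
  assumes "trivial_group G" shows "finitely_free G"
proof -
  have "(\<lambda>_. 0) \<in> iso G (free_Abelian_group ({} :: nat set))"
    using assms by (intro isoI homI) (auto simp: trivial_group_def bij_betw_def)
  then show ?thesis
    unfolding finitely_free_def by (metis finite.emptyI is_isoI)
qed

section \<open>Exact sequences of a pair\<close>

text \<open>This carries vanishing along the long exact sequence of a pair, from the space or the subspace to
  the other one, in the degrees where the relative homology vanishes.\<close>

lemma trivial_group_middle:
  assumes "exact_seq ([C, B, A], [g, f])" "trivial_group A" "trivial_group C"
  shows "trivial_group B"
proof -
  have gB: "group_hom B C g" and fA: "group_hom A B f" and im: "f ` carrier A = kernel B C g"
    using assms(1) by (auto simp: group_hom_def group_hom_axioms_def)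
  have "kernel B C g = carrier B" using gB assms(3) by (rule group_hom.kernel_to_trivial_group)
  moreover have "f ` carrier A = {\<one>\<^bsub>B\<^esub>}" using fA assms(2) by (rule group_hom.image_from_trivial_group)
  ultimately show ?thesis using im gB by (simp add: trivial_group_def group_hom_def)
qed

lemma trivial_homology_extend:
  assumes "trivial_group (relative_homology_group p X S)"
    and "trivial_group (homology_group p (subtopology X S))"
  shows "trivial_group (homology_group p X)"
  using trivial_group_middle [OF homology_exactness_axiom_3 assms(2,1)] .

lemma trivial_reduced_homology_restrict:
  assumes "trivial_group (relative_homology_group (p + 1) X S)"
    and "trivial_group (reduced_homology_group p X)"
  shows "trivial_group (reduced_homology_group p (subtopology X S))"
  using trivial_group_middle [OF homology_exactness_reduced_2 [of "p + 1" X S]] assms by simp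

lemma finitely_free_homology_extend:
  assumes "trivial_group (relative_homology_group (p + 1) X S)"
    and R: "relative_homology_group p X S \<cong> integer_group"
    and "finitely_free (homology_group p (subtopology X S))"
  shows "finitely_free (homology_group p X)"
proof -
  let ?A = "homology_group p (subtopology X S)" and ?X = "homology_group p X"
    and ?R = "relative_homology_group p X S"
  define i where "i = hom_induced p (subtopology X S) {} X {} id"
  define q where "q = hom_induced p X {} X S id"
  have ex: "exact_seq ([?R, ?X, ?A], [q, i])"
    unfolding i_def q_def by (rule homology_exactness_axiom_3)
  let ?b = "hom_boundary (p + 1) X S"
  have "exact_seq ([?X, ?A, relative_homology_group (p + 1) X S], [i, ?b])"
    using homology_exactness_axiom_2 [of "p + 1" X S] by (simp add: i_def)
  then have gi: "group_hom ?A ?X i" and gb: "group_hom (relative_homology_group (p + 1) X S) ?A ?b"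
    and ker: "?b ` carrier (relative_homology_group (p + 1) X S) = kernel ?A ?X i"
    by (auto simp: group_hom_def group_hom_axioms_def)
  have "kernel ?A ?X i = {\<one>\<^bsub>?A\<^esub>}"
    using group_hom.image_from_trivial_group [OF gb assms(1)] ker by simp
  then have i_inj: "inj_on i (carrier ?A)"
    using gi by (simp add: group_hom.inj_iff_trivial_ker)
  obtain B :: "nat set" where B: "finite B" "?A \<cong> free_Abelian_group B"
    using assms(3) by (auto simp: finitely_free_def)
  then have "free_Abelian_group B \<cong> ?A" by (simp add: group.iso_sym)
  then obtain j where j: "j \<in> iso (free_Abelian_group B) ?A" by (auto simp: is_iso_def)
  obtain z where z: "z \<in> iso ?R integer_group" using R by (auto simp: is_iso_def)
  have ih: "i \<in> hom ?A ?X" and qh: "q \<in> hom ?X ?R" and im: "i ` carrier ?A = kernel ?X ?R q"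
    using ex by (auto simp: group_hom_def group_hom_axioms_def)
  show ?thesis
  proof (rule finitely_free_extension)
    show "comm_group ?X" by (rule abelian_homology_group)
    show "finite B" by (rule B)
    show "i \<circ> j \<in> hom (free_Abelian_group B) ?X"
      using j ih by (auto simp: iso_def intro: hom_compose)
    show "inj_on (i \<circ> j) (carrier (free_Abelian_group B))"
      using j i_inj by (auto simp: iso_def bij_betw_def intro: comp_inj_on)
    show "z \<circ> q \<in> hom ?X integer_group"
      using z qh by (auto simp: iso_def intro: hom_compose)
    have "kernel ?X integer_group (z \<circ> q) = kernel ?X ?R q"
    proof -
      have "z u = 0 \<longleftrightarrow> u = \<one>\<^bsub>?R\<^esub>" if "u \<in> carrier ?R" for u
      proof -
        interpret z: group_hom ?R integer_group z
          using z by (simp add: group_hom_def group_hom_axioms_def iso_def)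
        have "inj_on z (carrier ?R)" using z by (simp add: iso_def bij_betw_def)
        then show ?thesis using that z.hom_one inj_onD [of z _ u] by (metis one_integer_group z.G.one_closed)
      qed
      moreover have "q x \<in> carrier ?R" if "x \<in> carrier ?X" for x
        using that qh by (auto simp: hom_def)
      ultimately show ?thesis by (auto simp: kernel_def)
    qed
    moreover have "(i \<circ> j) ` carrier (free_Abelian_group B) = i ` carrier ?A"
      unfolding image_comp [symmetric] using j by (simp add: iso_def bij_betw_def)
    ultimately show "(i \<circ> j) ` carrier (free_Abelian_group B) = kernel ?X integer_group (z \<circ> q)"
      using im by simp
  qed
qed

section \<open>The open cells of the cube\<close>

text \<open>
  The deformation retractions below move every point along a line segment that stays inside the
  larger set, so the homotopy is given by the retraction alone.
\<close>

lemma homotopy_equivalent_linear_retract: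
  fixes r :: "'a::real_normed_vector \<Rightarrow> 'a"
  assumes "S \<subseteq> Y" and r: "continuous_on Y r" "r ` Y \<subseteq> S" "\<And>x. x \<in> S \<Longrightarrow> r x = x"
    and seg: "\<And>x. x \<in> Y \<Longrightarrow> closed_segment x (r x) \<subseteq> Y"
  shows "top_of_set Y homotopy_equivalent_space top_of_set S"
proof -
  have "homotopic_with_canon (\<lambda>z. True) Y Y id r"
    using r(1) seg by (intro homotopic_with_linear) (auto simp: continuous_on_id)
  then have "homotopic_with (\<lambda>x. True) (top_of_set Y) (top_of_set Y) (id \<circ> r) id"
    by (simp add: homotopic_with_sym)
  moreover have "homotopic_with (\<lambda>x. True) (top_of_set S) (top_of_set S) (r \<circ> id) id"
    using r(3) by (intro homotopic_with_equal) (auto simp: continuous_map_iff_continuous intro: continuous_on_subset)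
  moreover have "continuous_map (top_of_set Y) (top_of_set S) r"
    using r by (auto simp: continuous_map_in_subtopology)
  moreover have "continuous_map (top_of_set S) (top_of_set Y) id"
    using \<open>S \<subseteq> Y\<close> by (auto simp: continuous_map_in_subtopology)
  ultimately show ?thesis unfolding homotopy_equivalent_space_def by blast
qed

lemma finite_vec_valued_in:
  assumes "finite A"
  shows "finite {x :: 'a ^ 'n::finite. \<forall>i. x $ i \<in> A}"
proof -
  have "{x :: 'a ^ 'n. \<forall>i. x $ i \<in> A} \<subseteq> vec_lambda ` (PiE UNIV (\<lambda>_. A))"
  proof
    fix x :: "'a ^ 'n" assume "x \<in> {x. \<forall>i. x $ i \<in> A}"
    then show "x \<in> vec_lambda ` (PiE UNIV (\<lambda>_. A))"
      by (intro image_eqI [of _ _ "vec_nth x"]) auto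
  qed
  then show ?thesis by (rule finite_subset) (intro finite_imageI finite_PiE assms; simp)
qed

definition cube :: "(real ^ 'n::finite) set" where
  "cube = {x. \<forall>i. \<bar>x $ i\<bar> \<le> 1}"

lemma cube_eq_cbox: "cube = cbox (-1) (1 :: real ^ 'n::finite)"
  by (auto simp: cube_def mem_box_cart abs_le_iff)

lemma compact_cube: "compact (cube :: (real ^ 'n::finite) set)"
  by (simp only: cube_eq_cbox compact_cbox)

lemma convex_cube: "convex (cube :: (real ^ 'n::finite) set)"
  by (simp only: cube_eq_cbox convex_box)

text \<open>A vector \<open>s\<close> with entries in \<open>{-1, 0, 1}\<close> encodes the face of the cube whose free coordinates are the
  zeros of \<open>s\<close>; the point \<open>s\<close> is the centre of that face.\<close>

definition cell :: "real ^ 'n::finite \<Rightarrow> (real ^ 'n) set" where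
  "cell s = {x. \<forall>i. if s $ i = 0 then \<bar>x $ i\<bar> < 1 else x $ i = s $ i}"

definition closed_cell :: "real ^ 'n::finite \<Rightarrow> (real ^ 'n) set" where
  "closed_cell s = {x. \<forall>i. if s $ i = 0 then \<bar>x $ i\<bar> \<le> 1 else x $ i = s $ i}"

definition cell_dim :: "real ^ 'n::finite \<Rightarrow> nat" where
  "cell_dim s = card {i. s $ i = 0}"

lemma center_in_cell: "s \<in> cell s"
  by (auto simp: cell_def)

lemma convex_box_cart:
  fixes I :: "'n::finite \<Rightarrow> real set"
  assumes "\<And>i. convex (I i)"
  shows "convex {x :: real ^ 'n. \<forall>i. x $ i \<in> I i}"
  using assms by (auto simp: convex_def)

lemma convex_cell: "convex (cell s)"
proof -
  have "cell s = {x. \<forall>i. x $ i \<in> (if s $ i = 0 then {-1<..<1} else {s $ i})}"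
    by (auto simp: cell_def abs_less_iff split: if_splits)
  then show ?thesis by (simp only:) (rule convex_box_cart, simp)
qed

lemma convex_closed_cell: "convex (closed_cell s)"
proof -
  have "closed_cell s = {x. \<forall>i. x $ i \<in> (if s $ i = 0 then {-1..1} else {s $ i})}"
    by (auto simp: closed_cell_def abs_le_iff split: if_splits)
  then show ?thesis by (simp only:) (rule convex_box_cart, simp)
qed

lemma closed_closed_cell:
  fixes s :: "real ^ 'n::finite"
  shows "closed (closed_cell s)"
proof -
  have "closed_cell s = (\<Inter>i. {x. if s $ i = 0 then \<bar>x $ i\<bar> \<le> 1 else x $ i = s $ i})"
    by (auto simp: closed_cell_def)
  moreover have "closed {x :: real ^ 'n. if s $ i = 0 then \<bar>x $ i\<bar> \<le> 1 else x $ i = s $ i}" for i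
    by (cases "s $ i = 0") (auto intro!: closed_Collect_le closed_Collect_eq continuous_intros)
  ultimately show ?thesis by (simp only: closed_INT ball_UNIV simp_thms)
qed

text \<open>Radial projection from the centre goes to the unit sphere in the span of the free coordinate
  axes. In the other direction the sphere is shrunk to radius \<open>1/2\<close>, since the unit sphere touches
  the boundary of the cell.\<close>

lemma punctured_cell_sphere:
  fixes s :: "real ^ 'n::finite"
  assumes "cell_dim s = d" "d \<noteq> 0"
  shows "top_of_set (cell s - {s}) homotopy_equivalent_space nsphere (d - 1)"
proof -
  define B :: "(real ^ 'n) set" where "B = (\<lambda>i. axis i 1) ` {i. s $ i = 0}"
  have BB: "B \<subseteq> Basis" by (auto simp: B_def Basis_vec_def)
  have "card B = d"
    using assms(1) unfolding B_def cell_dim_def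
    by (subst card_image) (auto simp: inj_on_def axis_eq_axis)
  have span: "span B = {y. \<forall>i. s $ i \<noteq> 0 \<longrightarrow> y $ i = 0}"
    unfolding span_substd_basis [OF BB]
    by (auto simp: B_def Basis_vec_def inner_axis axis_eq_axis)
  have "independent B" using BB independent_Basis independent_mono by blast
  moreover have "pairwise orthogonal B" using BB orthogonal_Basis pairwise_subset by blast
  moreover have "norm u = 1" if "u \<in> B" for u using that BB norm_Basis by blast
  ultimately obtain f :: "(nat \<Rightarrow> real) \<Rightarrow> real ^ 'n" and g
    where "homeomorphic_maps (nsphere (d - 1)) (top_of_set (sphere 0 1 \<inter> span B)) f g"
    using homeomorphic_maps_nsphere_euclidean_sphere [OF _ _ \<open>card B = d\<close> \<open>d \<noteq> 0\<close>] by blast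
  then have "nsphere (d - 1) homeomorphic_space top_of_set (sphere 0 1 \<inter> span B)"
    by (auto simp: homeomorphic_space_def)
  then have 1: "nsphere (d - 1) homotopy_equivalent_space top_of_set (sphere 0 1 \<inter> span B)"
    by (rule homeomorphic_imp_homotopy_equivalent_space)
  let ?E = "cell s - {s}" and ?S = "sphere 0 1 \<inter> span B"
  define p where "p x = (1 / norm (x - s)) *\<^sub>R (x - s)" for x
  define q where "q z = s + (1/2) *\<^sub>R z" for z
  have p: "p x \<in> ?S" if "x \<in> ?E" for x
    using that by (auto simp: p_def span cell_def)
  have q: "q z \<in> ?E" if "z \<in> ?S" for z
  proof -
    have "\<bar>z $ i\<bar> < 2" for i using that component_le_norm_cart [of z i] by simp
    moreover have "z \<noteq> 0" using that by auto
    ultimately show ?thesis using that by (auto simp: q_def cell_def span)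
  qed
  have "top_of_set ?E homotopy_equivalent_space top_of_set ?S"
    unfolding homotopy_equivalent_space_def
  proof (intro exI conjI)
    have cp: "continuous_on ?E p" unfolding p_def by (intro continuous_intros) auto
    show "continuous_map (top_of_set ?E) (top_of_set ?S) p"
      using p cp by (auto simp: continuous_map_in_subtopology)
    have cq: "continuous_on ?S q" unfolding q_def by (intro continuous_intros)
    show "continuous_map (top_of_set ?S) (top_of_set ?E) q"
      using q cq by (auto simp: continuous_map_in_subtopology)
    show "homotopic_with (\<lambda>x. True) (top_of_set ?S) (top_of_set ?S) (p \<circ> q) id"
      by (intro homotopic_with_equal continuous_map_compose [of _ "top_of_set ?E"])
        (use cp cq p q in \<open>auto simp: continuous_map_in_subtopology p_def q_def\<close>)
    show "homotopic_with (\<lambda>x. True) (top_of_set ?E) (top_of_set ?E) (q \<circ> p) id"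
    proof (rule homotopic_with_linear)
      show "continuous_on ?E (q \<circ> p)"
        by (rule continuous_on_compose [OF cp]) (use p cq in \<open>auto intro: continuous_on_subset\<close>)
      show "continuous_on ?E id" by (rule continuous_on_id')
      fix x assume x: "x \<in> ?E"
      have "closed_segment ((q \<circ> p) x) (id x) \<subseteq> cell s"
        using x q[OF p[OF x]] by (intro closed_segment_subset) (auto intro: convex_cell)
      moreover have "s \<notin> closed_segment ((q \<circ> p) x) (id x)"
      proof
        assume "s \<in> closed_segment ((q \<circ> p) x) (id x)"
        then obtain u where u: "0 \<le> u" "u \<le> 1" "s = (1 - u) *\<^sub>R q (p x) + u *\<^sub>R x"
          by (auto simp: in_segment)
        have n: "norm (x - s) > 0" using x by simp
        have "(1 - u) *\<^sub>R q (p x) + u *\<^sub>R x - s = ((1 - u) / (2 * norm (x - s)) + u) *\<^sub>R (x - s)"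
          by (simp add: q_def p_def algebra_simps)
        moreover have "(1 - u) / (2 * norm (x - s)) + u > 0"
          using u n by (cases "u = 0") (auto intro: add_nonneg_pos)
        ultimately show False using u(3) x by simp
      qed
      ultimately show "closed_segment ((q \<circ> p) x) (id x) \<subseteq> ?E" by blast
    qed
  qed
  then show ?thesis using 1 homotopy_equivalent_space_sym homotopy_eqv_trans by blast
qed

text \<open>A cell is contractible, so its homology relative to the punctured cell is the reduced homology of
  a sphere in one degree lower. A cell of dimension \<open>0\<close> is a point, removing its centre
  leaves nothing, and the dimension axiom gives the nonzero degrees.\<close>

lemma relative_homology_punctured_cell:
  assumes "cell_dim s = d"
  shows "p \<noteq> 0 \<or> d \<noteq> 0 \<Longrightarrow> p \<noteq> int d \<Longrightarrow> trivial_group (relative_homology_group p (top_of_set (cell s)) (cell s - {s}))"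
    and "d \<noteq> 0 \<Longrightarrow> relative_homology_group (int d) (top_of_set (cell s)) (cell s - {s}) \<cong> integer_group"
proof -
  let ?E = "top_of_set (cell s)" and ?P = "cell s - {s}"
  have iso: "relative_homology_group p ?E ?P \<cong> reduced_homology_group (p - 1) (nsphere (d - 1))"
    if "d \<noteq> 0" for p
  proof -
    have he: "top_of_set ?P homotopy_equivalent_space nsphere (d - 1)"
      by (rule punctured_cell_sphere [OF assms that])
    have "?P \<noteq> {}"
    proof -
      have "card {i. s $ i = 0} \<noteq> 0" using assms that by (simp add: cell_dim_def)
      then have "{i. s $ i = 0} \<noteq> {}" by (intro notI) simp
      then obtain i where "s $ i = 0" by blast
      then have "s + axis i (1/2) \<in> ?P" by (auto simp: cell_def axis_def vec_eq_iff)
      then show ?thesis by blast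
    qed
    then have "relative_homology_group p ?E ?P \<cong> reduced_homology_group (p - 1) (subtopology ?E ?P)"
      by (intro isomorphic_group_relative_homology_of_contractible)
        (auto simp: convex_cell convex_imp_contractible)
    also have "subtopology ?E ?P = top_of_set ?P"
      by (simp add: subtopology_subtopology Int_absorb1)
    also have "reduced_homology_group (p - 1) \<dots> \<cong> reduced_homology_group (p - 1) (nsphere (d - 1))"
      by (rule homotopy_equivalent_space_imp_isomorphic_reduced_homology_groups [OF he])
    finally show ?thesis .
  qed
  show "trivial_group (relative_homology_group p ?E ?P)" if "p \<noteq> 0 \<or> d \<noteq> 0" "p \<noteq> int d"
  proof (cases "d = 0")
    case True
    then have "cell s = {s}"
      using assms by (auto simp: cell_dim_def cell_def vec_eq_iff)
    then show ?thesis using that True homology_dimension_axiom [of ?E s p] by simp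
  next
    case False
    have "trivial_group (reduced_homology_group (p - 1) (nsphere (d - 1)))"
      using that False by (subst trivial_reduced_homology_group_nsphere) auto
    then show ?thesis
      using isomorphic_group_triviality [OF iso [OF False, of p]] by simp
  qed
  show "relative_homology_group (int d) ?E ?P \<cong> integer_group" if "d \<noteq> 0"
  proof -
    have d: "int d - 1 = int (d - 1)" using that by simp
    have "relative_homology_group (int d) ?E ?P \<cong> reduced_homology_group (int (d - 1)) (nsphere (d - 1))"
      using iso [OF that, of "int d"] by (simp only: d)
    also have "\<dots> \<cong> integer_group" by (rule reduced_homology_group_nsphere(1))
    finally show ?thesis .
  qed
qed

definition cell_centers :: "(real ^ 'n::finite) set" where
  "cell_centers = {s. \<forall>i. s $ i \<in> {-1, 0, 1}}"

definition cell_union :: "(real ^ 'n::finite) set \<Rightarrow> (real ^ 'n) set" where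
  "cell_union K = (\<Union>s \<in> K. cell s)"

text \<open>The cell of \<open>t\<close> is a face of the closed cell of \<open>s\<close> exactly when its centre \<open>t\<close> lies in that closed cell.\<close>

definition face_closed :: "(real ^ 'n::finite) set \<Rightarrow> bool" where
  "face_closed K \<longleftrightarrow> K \<subseteq> cell_centers \<and> (\<forall>s \<in> K. closed_cell s \<inter> cell_centers \<subseteq> K)"

lemma finite_cell_centers: "finite (cell_centers :: (real ^ 'n::finite) set)"
  unfolding cell_centers_def by (rule finite_vec_valued_in) simp

lemma cell_subset_closed_cell: "cell s \<subseteq> closed_cell s"
  by (auto simp: cell_def closed_cell_def less_imp_le split: if_splits)

lemma cell_disjoint:
  assumes "s \<in> cell_centers" "t \<in> cell_centers" "x \<in> cell s" "x \<in> cell t"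
  shows "s = t"
proof -
  have "s $ i = t $ i" for i
    using assms by (auto simp: cell_centers_def cell_def dest!: spec [of _ i] split: if_splits)
  then show ?thesis by (simp add: vec_eq_iff)
qed

lemma closed_cell_point_face:
  assumes "s \<in> cell_centers" "x \<in> closed_cell s"
  obtains t where "t \<in> cell_centers" "t \<in> closed_cell s" "x \<in> cell t"
proof
  let ?t = "\<chi> i. if \<bar>x $ i\<bar> = 1 then x $ i else 0"
  show "?t \<in> cell_centers" by (auto simp: cell_centers_def)
  have x: "\<bar>x $ i\<bar> \<le> 1" "s $ i \<noteq> 0 \<Longrightarrow> x $ i = s $ i \<and> \<bar>x $ i\<bar> = 1" for i
    using assms by (auto simp: cell_centers_def closed_cell_def dest!: spec [of _ i] split: if_splits)
  have "if s $ i = 0 then \<bar>?t $ i\<bar> \<le> 1 else ?t $ i = s $ i" for i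
    using x(1)[of i] x(2)[of i] by (cases "s $ i = 0") auto
  then show "?t \<in> closed_cell s" unfolding closed_cell_def by blast
  show "x \<in> cell ?t" using x(1) by (auto simp: cell_def less_le)
qed

lemma cell_dim_face:
  assumes "s \<in> cell_centers" "t \<in> cell_centers" "t \<in> closed_cell s" "t \<noteq> s"
  shows "cell_dim t < cell_dim s"
proof -
  have eq: "s $ i \<noteq> 0 \<Longrightarrow> t $ i = s $ i" for i
    using assms(3) by (auto simp: closed_cell_def dest!: spec [of _ i] split: if_splits)
  obtain j where "t $ j \<noteq> s $ j" using \<open>t \<noteq> s\<close> by (auto simp: vec_eq_iff)
  then have "s $ j = 0" "t $ j \<noteq> 0" using eq[of j] by auto
  have "{i. t $ i = 0} \<subset> {i. s $ i = 0}"
  proof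
    show "{i. t $ i = 0} \<subseteq> {i. s $ i = 0}" using eq by fastforce
    show "{i. t $ i = 0} \<noteq> {i. s $ i = 0}" using \<open>s $ j = 0\<close> \<open>t $ j \<noteq> 0\<close> by blast
  qed
  then show ?thesis unfolding cell_dim_def by (intro psubset_card_mono) auto
qed

lemma cell_union_closed_cells:
  assumes "face_closed K"
  shows "cell_union K = (\<Union>s \<in> K. closed_cell s)"
proof
  show "cell_union K \<subseteq> (\<Union>s \<in> K. closed_cell s)"
    using cell_subset_closed_cell by (fastforce simp: cell_union_def)
  show "(\<Union>s \<in> K. closed_cell s) \<subseteq> cell_union K"
  proof
    fix x assume "x \<in> (\<Union>s \<in> K. closed_cell s)"
    then obtain s where s: "s \<in> K" "x \<in> closed_cell s" by blast
    then obtain t where "t \<in> cell_centers" "t \<in> closed_cell s" "x \<in> cell t"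
      using assms closed_cell_point_face by (metis face_closed_def subsetD)
    then show "x \<in> cell_union K" using s assms by (auto simp: cell_union_def face_closed_def)
  qed
qed

lemma closed_cell_union:
  assumes "face_closed K"
  shows "closed (cell_union K)"
proof -
  have "finite K" using assms finite_cell_centers finite_subset by (auto simp: face_closed_def)
  then show ?thesis
    unfolding cell_union_closed_cells [OF assms] by (intro closed_UN ballI closed_closed_cell)
qed

text \<open>On a closed cell the distance from the centre in the maximum norm is at most \<open>1\<close>, and it is \<open>1\<close>
  exactly on the boundary. Attainment of the norm by a coordinate is what gives the strict
  inequality in the interior.\<close>

lemma infnorm_attained:
  fixes x :: "real ^ 'n::finite"
  obtains i where "infnorm x = \<bar>x $ i\<bar>"
proof -
  have "infnorm x \<in> (\<lambda>b. \<bar>x \<bullet> b\<bar>) ` Basis"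
    unfolding infnorm_Max by (intro Max_in) auto
  then obtain b :: "real ^ 'n" where "b \<in> Basis" "infnorm x = \<bar>x \<bullet> b\<bar>" by blast
  moreover then obtain i where "b = axis i 1" by (auto simp: Basis_vec_def)
  ultimately show thesis using that[of i] by (simp add: inner_axis)
qed

section \<open>Attaching one cell\<close>

text \<open>Since all proper faces of the new cell are present, both complexes are closed sets and the new open
  cell is exactly what is added to the old one.\<close>

locale attached_cell =
  fixes K :: "(real ^ 'n::finite) set" and s :: "real ^ 'n"
  assumes K: "face_closed K" and s: "s \<in> cell_centers" "s \<notin> K"
    and faces: "closed_cell s \<inter> cell_centers \<subseteq> insert s K"
begin

lemma face_closed_insert: "face_closed (insert s K)"
  using K s faces by (auto simp: face_closed_def)

lemma cell_union_insert: "cell_union (insert s K) = cell_union K \<union> cell s"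
  by (auto simp: cell_union_def)

lemma cell_union_disjoint: "cell_union K \<inter> cell s = {}"
  using K s cell_disjoint by (fastforce simp: cell_union_def face_closed_def)

lemma cell_union_minus_cell: "cell_union (insert s K) - cell_union K = cell s"
  using cell_union_insert cell_union_disjoint by blast

text \<open>The closed subcomplex avoids the new centre, so it may be excised, and only the open cell is left.\<close>

lemma relative_homology_center:
  "relative_homology_group p (top_of_set (cell s)) (cell s - {s})
    \<cong> relative_homology_group p (top_of_set (cell_union (insert s K))) (cell_union (insert s K) - {s})"
proof -
  let ?X = "cell_union (insert s K)" and ?A = "cell_union K"
  have A: "closedin (top_of_set ?X) ?A"
    by (rule closed_subset) (auto simp: cell_union_def closed_cell_union [OF K, unfolded cell_union_def])
  have "?A \<subseteq> ?X - {s}" using cell_union_insert cell_union_disjoint center_in_cell by blast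
  moreover have "openin (top_of_set ?X) (?X - {s})"
    by (metis openin_delete openin_subtopology_self)
  ultimately have "(top_of_set ?X) closure_of ?A \<subseteq> (top_of_set ?X) interior_of (?X - {s})"
    using A by (simp add: closure_of_closedin interior_of_openin)
  from homology_excision_axiom [OF this Diff_subset, of p]
  have "relative_homology_group p (subtopology (top_of_set ?X) (?X - ?A)) (?X - {s} - ?A)
      \<cong> relative_homology_group p (subtopology (top_of_set ?X) ?X) (?X - {s})"
    by (rule is_isoI)
  moreover have "?X - {s} - ?A = cell s - {s}" using cell_union_minus_cell by blast
  moreover have "subtopology (top_of_set ?X) (?X - ?A) = top_of_set (cell s)"
    unfolding cell_union_minus_cell by (simp add: subtopology_subtopology cell_union_insert Int_absorb1)
  ultimately show ?thesis by (simp add: subtopology_subtopology)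
qed

text \<open>With its centre removed, the new cell can be pushed radially, in the maximum norm, onto its
  boundary, which belongs to the old complex.\<close>

lemma homotopy_equivalent_punctured:
  "top_of_set (cell_union (insert s K) - {s}) homotopy_equivalent_space top_of_set (cell_union K)"
proof -
  let ?X = "cell_union (insert s K)" and ?A = "cell_union K" and ?C = "closed_cell s - {s}"
  define \<rho> where "\<rho> x = s + (1 / infnorm (x - s)) *\<^sub>R (x - s)" for x
  define r where "r x = (if x \<in> ?A then x else \<rho> x)" for x
  have infnorm_pos: "0 < infnorm (x - s)" if "x \<noteq> s" for x
    using that by (simp add: infnorm_pos_lt)
  have sub: "closed_cell s \<subseteq> ?X"
    using cell_union_closed_cells [OF face_closed_insert] by blast
  have sA: "s \<notin> ?A" using cell_union_disjoint center_in_cell by blast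
  have X: "?X - {s} = ?A \<union> ?C"
    using cell_union_insert sub cell_subset_closed_cell sA by blast
  have on_cell: "x \<in> cell s \<longleftrightarrow> infnorm (x - s) < 1" if x: "x \<in> closed_cell s" for x
  proof
    assume "x \<in> cell s"
    obtain i where i: "infnorm (x - s) = \<bar>(x - s) $ i\<bar>" by (rule infnorm_attained)
    have "\<bar>(x - s) $ i\<bar> < 1" using \<open>x \<in> cell s\<close> by (auto simp: cell_def dest: spec [of _ i] split: if_splits)
    then show "infnorm (x - s) < 1" using i by simp
  next
    assume "infnorm (x - s) < 1"
    then have "\<bar>(x - s) $ i\<bar> < 1" for i using component_le_infnorm_cart [of "x - s" i] by linarith
    then have "if s $ i = 0 then \<bar>x $ i\<bar> < 1 else x $ i = s $ i" for i
      using x by (auto simp: closed_cell_def dest: spec [of _ i] split: if_splits)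
        (metis diff_zero)
    then show "x \<in> cell s" by (simp add: cell_def)
  qed
  have le1: "infnorm (x - s) \<le> 1" if x: "x \<in> closed_cell s" for x
  proof -
    obtain i where i: "infnorm (x - s) = \<bar>(x - s) $ i\<bar>" by (rule infnorm_attained)
    have "\<bar>(x - s) $ i\<bar> \<le> 1" using x by (auto simp: closed_cell_def dest: spec [of _ i] split: if_splits)
    then show ?thesis using i by simp
  qed
  have infnorm_\<rho>: "infnorm (\<rho> x - s) = 1" if "x \<noteq> s" for x
    using infnorm_pos [OF that] by (simp add: \<rho>_def infnorm_mul)
  have \<rho>_in: "\<rho> x \<in> closed_cell s" if x: "x \<in> ?C" for x
  proof -
    have "\<rho> x $ i = s $ i" if "s $ i \<noteq> 0" for i
      using x that by (auto simp: \<rho>_def closed_cell_def dest: spec [of _ i])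
    moreover have "\<bar>\<rho> x $ i\<bar> \<le> 1" if "s $ i = 0" for i
      using component_le_infnorm_cart [of "\<rho> x - s" i] infnorm_\<rho> [of x] x that by simp
    ultimately show ?thesis by (simp add: closed_cell_def)
  qed
  have \<rho>_A: "\<rho> x \<in> ?A" if x: "x \<in> ?C" for x
    using \<rho>_in [OF x] on_cell [OF \<rho>_in [OF x]] infnorm_\<rho> [of x] x sub cell_union_insert by auto
  have \<rho>_fix: "\<rho> x = x" if "x \<in> ?C" "x \<in> ?A" for x
  proof -
    have "infnorm (x - s) = 1"
      using that on_cell [of x] le1 [of x] cell_union_disjoint by force
    then show ?thesis by (simp add: \<rho>_def)
  qed
  show ?thesis
  proof (rule homotopy_equivalent_linear_retract)
    show "?A \<subseteq> ?X - {s}" using X by blast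
    show "r ` (?X - {s}) \<subseteq> ?A" unfolding X using \<rho>_A by (auto simp: r_def)
    show "r x = x" if "x \<in> ?A" for x using that by (simp add: r_def)
    have "continuous_on (?A \<union> ?C) r"
      unfolding r_def
    proof (rule continuous_on_cases_local)
      show "closedin (top_of_set (?A \<union> ?C)) ?A"
        by (intro closed_subset closed_cell_union K) auto
      have "?C = (?A \<union> ?C) \<inter> closed_cell s" using sA by blast
      then show "closedin (top_of_set (?A \<union> ?C)) ?C"
        using closed_closed_cell by (metis closedin_closed_Int)
      show "continuous_on ?C \<rho>"
        unfolding \<rho>_def by (intro continuous_intros) (auto simp: infnorm_eq_0)
    qed (use \<rho>_fix in \<open>auto intro: continuous_on_id\<close>)
    then show "continuous_on (?X - {s}) r" unfolding X .
    show "closed_segment x (r x) \<subseteq> ?X - {s}" if x: "x \<in> ?X - {s}" for x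
    proof (cases "x \<in> ?A")
      case True then show ?thesis using x by (simp add: r_def)
    next
      case False
      then have xC: "x \<in> ?C" using x X by blast
      then have "closed_segment x (\<rho> x) \<subseteq> closed_cell s"
        using \<rho>_in by (intro closed_segment_subset convex_closed_cell) auto
      moreover have "s \<notin> closed_segment x (\<rho> x)"
      proof
        assume "s \<in> closed_segment x (\<rho> x)"
        then obtain u where u: "0 \<le> u" "u \<le> 1" "s = (1 - u) *\<^sub>R x + u *\<^sub>R \<rho> x"
          by (auto simp: in_segment)
        have "(1 - u) *\<^sub>R x + u *\<^sub>R \<rho> x - s = ((1 - u) + u / infnorm (x - s)) *\<^sub>R (x - s)"
          by (simp add: \<rho>_def algebra_simps)
        moreover have "(1 - u) + u / infnorm (x - s) > 0"
          using u infnorm_pos [of x] xC by (cases "u = 0") (auto intro: add_nonneg_pos)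
        ultimately show False using u(3) xC by simp
      qed
      ultimately show ?thesis using False sub by (auto simp: r_def)
    qed
  qed
qed

lemma subtopology_punctured:
  "subtopology (top_of_set (cell_union (insert s K))) (cell_union (insert s K) - {s})
    = top_of_set (cell_union (insert s K) - {s})"
  by (simp add: subtopology_subtopology Int_absorb1)

lemma trivial_relative_homology:
  assumes "p \<noteq> 0 \<or> cell_dim s \<noteq> 0" "p \<noteq> int (cell_dim s)"
  shows "trivial_group (relative_homology_group p (top_of_set (cell_union (insert s K))) (cell_union (insert s K) - {s}))"
  using isomorphic_group_triviality [OF relative_homology_center [of p]]
    relative_homology_punctured_cell(1) [OF refl assms] by simp

lemma trivial_homology_attach:
  assumes "p \<noteq> 0" "p \<noteq> int (cell_dim s)"
    and "trivial_group (homology_group p (top_of_set (cell_union K)))"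
  shows "trivial_group (homology_group p (top_of_set (cell_union (insert s K))))"
proof (rule trivial_homology_extend)
  show "trivial_group (relative_homology_group p (top_of_set (cell_union (insert s K))) (cell_union (insert s K) - {s}))"
    using assms by (intro trivial_relative_homology) auto
  show "trivial_group (homology_group p (subtopology (top_of_set (cell_union (insert s K))) (cell_union (insert s K) - {s})))"
    unfolding subtopology_punctured
    using isomorphic_group_triviality
        [OF homotopy_equivalent_space_imp_isomorphic_homology_groups [OF homotopy_equivalent_punctured, of p]]
      assms(3) by simp
qed

lemma finitely_free_homology_attach:
  assumes "cell_dim s = d" "d \<noteq> 0" "finitely_free (homology_group (int d) (top_of_set (cell_union K)))"
  shows "finitely_free (homology_group (int d) (top_of_set (cell_union (insert s K))))"
proof (rule finitely_free_homology_extend)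
  let ?X = "cell_union (insert s K)"
  show "trivial_group (relative_homology_group (int d + 1) (top_of_set ?X) (?X - {s}))"
    using assms by (intro trivial_relative_homology) auto
  have "relative_homology_group (int d) (top_of_set ?X) (?X - {s})
      \<cong> relative_homology_group (int d) (top_of_set (cell s)) (cell s - {s})"
    by (rule group.iso_sym [OF _ relative_homology_center]) simp
  also have "\<dots> \<cong> integer_group"
    by (rule relative_homology_punctured_cell(2) [OF assms(1,2)])
  finally show "relative_homology_group (int d) (top_of_set ?X) (?X - {s}) \<cong> integer_group" .
  show "finitely_free (homology_group (int d) (subtopology (top_of_set ?X) (?X - {s})))"
    unfolding subtopology_punctured
    using assms(3) homotopy_equivalent_space_imp_isomorphic_homology_groups [OF homotopy_equivalent_punctured]
    by (rule finitely_free_iso)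
qed

lemma trivial_reduced_homology_detach:
  assumes "cell_dim s \<noteq> 0" "p + 1 \<noteq> int (cell_dim s)"
    and "trivial_group (reduced_homology_group p (top_of_set (cell_union (insert s K))))"
  shows "trivial_group (reduced_homology_group p (top_of_set (cell_union K)))"
proof -
  have "trivial_group (reduced_homology_group p (top_of_set (cell_union (insert s K) - {s})))"
    unfolding subtopology_punctured [symmetric]
    using assms by (intro trivial_reduced_homology_restrict [where X = "top_of_set (cell_union (insert s K))"]
        trivial_relative_homology) auto
  then show ?thesis
    using isomorphic_group_triviality
        [OF homotopy_equivalent_space_imp_isomorphic_reduced_homology_groups [OF homotopy_equivalent_punctured, of p]]
    by simp
qed

end

section \<open>Homology of the skeleta of the cube\<close>

text \<open>The bound on the dimension is strict: \<open>skeleton j\<close> is the skeleton of dimension \<open>j - 1\<close>, and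
  \<open>skeleton 0\<close> is empty, which is a convenient start for induction.\<close>

definition skeleton :: "nat \<Rightarrow> (real ^ 'n::finite) set" where
  "skeleton j = {x \<in> cube. card {i. \<bar>x $ i\<bar> \<noteq> 1} < j}"

definition cells_below :: "nat \<Rightarrow> (real ^ 'n::finite) set" where
  "cells_below j = {s \<in> cell_centers. cell_dim s < j}"

lemma face_closed_cells_below: "face_closed (cells_below j)"
  using cell_dim_face by (fastforce simp: face_closed_def cells_below_def)

lemma cell_union_cells_below: "cell_union (cells_below j) = skeleton j"
proof
  have *: "cell_dim s = card {i. \<bar>x $ i\<bar> \<noteq> 1}" "\<bar>x $ i\<bar> \<le> 1" if "s \<in> cell_centers" "x \<in> cell s" for s x :: "real ^ 'n" and i
  proof -
    have "s $ i = 0 \<longleftrightarrow> \<bar>x $ i\<bar> \<noteq> 1" "\<bar>x $ i\<bar> \<le> 1" for i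
      using that by (auto simp: cell_centers_def cell_def dest!: spec [of _ i] split: if_splits)
    then show "cell_dim s = card {i. \<bar>x $ i\<bar> \<noteq> 1}" "\<bar>x $ i\<bar> \<le> 1" by (auto simp: cell_dim_def)
  qed
  show "cell_union (cells_below j) \<subseteq> skeleton j"
    using * by (fastforce simp: cell_union_def cells_below_def skeleton_def cube_def)
  show "skeleton j \<subseteq> cell_union (cells_below j)"
  proof
    fix x :: "real ^ 'n" assume x: "x \<in> skeleton j"
    have "x \<in> closed_cell 0" using x by (auto simp: skeleton_def cube_def closed_cell_def)
    then obtain t where t: "t \<in> cell_centers" "x \<in> cell t"
      by (rule closed_cell_point_face [rotated]) (auto simp: cell_centers_def)
    then show "x \<in> cell_union (cells_below j)"
      using * [of t x] x by (auto simp: cell_union_def cells_below_def skeleton_def cube_def)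
  qed
qed

text \<open>The cells of dimension \<open>j\<close> can be attached in any order, since their proper faces all have smaller
  dimension.\<close>

lemma skeleton_step:
  fixes Q :: "(real ^ 'n::finite) set \<Rightarrow> bool"
  assumes base: "Q (cells_below j)"
    and step: "\<And>K s. attached_cell K s \<Longrightarrow> cell_dim s = j \<Longrightarrow> Q K \<Longrightarrow> Q (insert s K)"
  shows "Q (cells_below (Suc j))"
proof -
  have "face_closed (cells_below j \<union> N) \<and> Q (cells_below j \<union> N)"
    if "finite N" "N \<subseteq> {s \<in> cell_centers. cell_dim s = j}" for N
    using that
  proof (induction N rule: finite_induct)
    case empty
    then show ?case using base face_closed_cells_below by simp
  next
    case (insert s N)
    have sj: "s \<in> cell_centers" "cell_dim s = j" using insert by auto
    interpret attached_cell "cells_below j \<union> N" s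
    proof
      show "face_closed (cells_below j \<union> N)" using insert by simp
      show "s \<notin> cells_below j \<union> N" using insert by (auto simp: cells_below_def)
      show "closed_cell s \<inter> cell_centers \<subseteq> insert s (cells_below j \<union> N)"
        using cell_dim_face [OF sj(1)] sj(2) by (auto simp: cells_below_def)
    qed (rule sj)
    show ?case
      using face_closed_insert step [OF attached_cell_axioms sj(2)] insert by simp
  qed
  moreover have "finite {s \<in> cell_centers :: (real ^ 'n) set. cell_dim s = j}"
    by (rule finite_subset [OF _ finite_cell_centers]) auto
  ultimately
  have "Q (cells_below j \<union> {s \<in> cell_centers. cell_dim s = j})"
    by blast
  moreover have "cells_below j \<union> {s \<in> cell_centers. cell_dim s = j} = (cells_below (Suc j) :: (real ^ 'n) set)"
    by (auto simp: cells_below_def)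
  ultimately show ?thesis by simp
qed

lemma trivial_homology_skeleton_above:
  assumes "int j \<le> p" "p \<noteq> 0"
  shows "trivial_group (homology_group p (top_of_set (cell_union (cells_below j) :: (real ^ 'n::finite) set)))"
  using assms(1)
proof (induction j)
  case 0
  have "cell_union (cells_below 0) = ({} :: (real ^ 'n) set)" by (simp add: cell_union_def cells_below_def)
  then show ?case by (simp add: trivial_homology_group_empty)
next
  case (Suc j)
  show ?case
  proof (rule skeleton_step [where Q = "\<lambda>K. trivial_group (homology_group p (top_of_set (cell_union K)))"])
    show "trivial_group (homology_group p (top_of_set (cell_union (cells_below j) :: (real ^ 'n) set)))"
      using Suc by simp
  qed (use Suc.prems assms(2) in \<open>auto intro!: attached_cell.trivial_homology_attach\<close>)
qed

text \<open>Before the cells of dimension \<open>j\<close> are attached, the homology in degree \<open>j\<close> is zero, in particular free;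
  each of these cells preserves freeness.\<close>

lemma finitely_free_homology_skeleton:
  assumes "j \<noteq> 0"
  shows "finitely_free (homology_group (int j) (top_of_set (cell_union (cells_below (Suc j)) :: (real ^ 'n::finite) set)))"
proof (rule skeleton_step [where Q = "\<lambda>K. finitely_free (homology_group (int j) (top_of_set (cell_union K)))"])
  show "finitely_free (homology_group (int j) (top_of_set (cell_union (cells_below j) :: (real ^ 'n) set)))"
    using assms by (intro finitely_free_trivial trivial_homology_skeleton_above) auto
qed (use assms in \<open>auto intro: attached_cell.finitely_free_homology_attach\<close>)

text \<open>Attaching a cell of dimension \<open>d\<close> cannot kill homology below degree \<open>d - 1\<close>. So a class in degree \<open>p\<close>
  would survive all the way up to the full cube, which is contractible.\<close>

lemma trivial_reduced_homology_skeleton_below: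
  assumes "p + 1 < int j" "j \<noteq> 0"
  shows "trivial_group (reduced_homology_group p (top_of_set (cell_union (cells_below j) :: (real ^ 'n::finite) set)))"
proof -
  let ?Q = "\<lambda>K :: (real ^ 'n) set. trivial_group (reduced_homology_group p (top_of_set (cell_union K)))"
  define N where "N = Suc (max j CARD('n))"
  have "?Q (cells_below N) \<longrightarrow> ?Q (cells_below j)"
  proof -
    have "?Q (cells_below (j + m)) \<longrightarrow> ?Q (cells_below j)" for m
    proof (induction m)
      case (Suc m)
      have "?Q (cells_below (Suc (j + m))) \<longrightarrow> ?Q (cells_below (j + m))"
        by (rule skeleton_step) (use assms in \<open>auto intro: attached_cell.trivial_reduced_homology_detach\<close>)
      then show ?case using Suc by simp
    qed simp
    from this [of "N - j"] show ?thesis by (simp add: N_def)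
  qed
  moreover have "?Q (cells_below N)"
  proof -
    have "card S < N" for S :: "'n set" using card_mono [OF finite subset_UNIV [of S]] by (simp add: N_def)
    then have "cell_union (cells_below N) = closed_cell (0 :: real ^ 'n)"
      unfolding cell_union_cells_below by (auto simp: skeleton_def cube_def closed_cell_def)
    then show ?thesis
      by (simp add: trivial_reduced_homology_group_contractible_space convex_imp_contractible convex_closed_cell)
  qed
  ultimately show ?thesis by blast
qed

section \<open>The half cube as a truncated cube\<close>

definition sign_vectors :: "(real ^ 'n::finite) set" where
  "sign_vectors = {w. \<forall>i. w $ i = 1 \<or> w $ i = -1}"

definition odd_vertices :: "(real ^ 'n::finite) set" where
  "odd_vertices = {w \<in> sign_vectors. odd (card {i. w $ i < 0})}"

definition flip :: "'n::finite \<Rightarrow> real ^ 'n \<Rightarrow> real ^ 'n" where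
  "flip i v = (\<chi> j. if j = i then - v $ j else v $ j)"

lemma flip_sign_vector: "v \<in> sign_vectors \<Longrightarrow> flip i v \<in> sign_vectors"
  by (auto simp: flip_def sign_vectors_def)

lemma sign_vector_mult_self: "v \<in> sign_vectors \<Longrightarrow> v $ i * v $ i = 1"
  by (auto simp: sign_vectors_def dest: spec [of _ i])

lemma sign_vector_abs: "v \<in> sign_vectors \<Longrightarrow> \<bar>v $ i\<bar> = 1"
  by (auto simp: sign_vectors_def dest: spec [of _ i])

lemma Psi_eq: "Psi = {v \<in> sign_vectors. even (card {i. v $ i < 0})}"
  by (auto simp: Psi_def sign_vectors_def)

lemma odd_vertices_sign: "w \<in> odd_vertices \<Longrightarrow> w \<in> sign_vectors"
  by (simp add: odd_vertices_def)

lemma sign_vectors_cases: "v \<in> sign_vectors \<Longrightarrow> v \<in> Psi \<or> v \<in> odd_vertices"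
  by (auto simp: Psi_eq odd_vertices_def)

lemma odd_vertices_not_Psi: "w \<in> odd_vertices \<Longrightarrow> w \<notin> Psi"
  by (auto simp: Psi_eq odd_vertices_def)

lemma flip_parity:
  assumes "v \<in> sign_vectors"
  shows "odd (card {j. flip i v $ j < 0}) \<longleftrightarrow> even (card {j. v $ j < 0})"
proof (cases "v $ i < 0")
  case True
  then have "{j. v $ j < 0} = insert i {j. flip i v $ j < 0}" "i \<notin> {j. flip i v $ j < 0}"
    by (auto simp: flip_def)
  then show ?thesis by simp
next
  case False
  then have "v $ i > 0" using assms by (auto simp: sign_vectors_def dest: spec [of _ i])
  then have "{j. flip i v $ j < 0} = insert i {j. v $ j < 0}" "i \<notin> {j. v $ j < 0}"
    by (auto simp: flip_def)
  then show ?thesis by simp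
qed

lemma flip_Psi: "v \<in> Psi \<Longrightarrow> flip i v \<in> odd_vertices"
  using flip_parity [of v i] flip_sign_vector [of v i] by (auto simp: Psi_eq odd_vertices_def)

lemma flip_odd_vertices: "w \<in> odd_vertices \<Longrightarrow> flip i w \<in> Psi"
  using flip_parity [of w i] flip_sign_vector [of w i] by (auto simp: Psi_eq odd_vertices_def)

lemma finite_sign_vectors: "finite (sign_vectors :: (real ^ 'n::finite) set)"
  using finite_vec_valued_in [of "{1, -1 :: real}"] by (simp add: sign_vectors_def)

lemma finite_odd_vertices: "finite (odd_vertices :: (real ^ 'n::finite) set)"
  by (rule finite_subset [OF _ finite_sign_vectors]) (auto simp: odd_vertices_def)

lemma finite_Psi: "finite (Psi :: (real ^ 'n::finite) set)"
  by (rule finite_subset [OF _ finite_sign_vectors]) (auto simp: Psi_eq)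

lemma inner_cart: "(x :: real ^ 'n::finite) \<bullet> y = (\<Sum>i\<in>UNIV. x $ i * y $ i)"
  by (simp add: inner_vec_def)

lemma sign_mult_le:
  assumes "w \<in> sign_vectors" "x \<in> cube"
  shows "w $ i * x $ i \<le> 1"
proof -
  have "\<bar>w $ i * x $ i\<bar> \<le> 1"
    using assms sign_vector_abs [of w i] by (simp add: abs_mult cube_def)
  then show ?thesis by linarith
qed

text \<open>Changing the sign of a single coordinate changes the parity, so distinct odd vertices differ in at
  least two coordinates.\<close>

lemma odd_vertices_agree_card:
  fixes w w' :: "real ^ 'n::finite"
  assumes "w \<in> odd_vertices" "w' \<in> odd_vertices" "w \<noteq> w'"
  shows "card {i. w $ i = w' $ i} + 2 \<le> CARD('n)"
proof -
  let ?D = "{i. w $ i \<noteq> w' $ i}"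
  have sv: "w \<in> sign_vectors" "w' \<in> sign_vectors" using assms odd_vertices_sign by auto
  obtain i where i: "w $ i \<noteq> w' $ i" using assms by (auto simp: vec_eq_iff)
  have "?D \<noteq> {i}"
  proof
    assume D: "?D = {i}"
    have "w' $ j = flip i w $ j" for j
    proof (cases "j = i")
      case True
      then show ?thesis using i sv by (auto simp: flip_def sign_vectors_def dest!: spec [of _ i])
    next
      case False
      then have "j \<notin> ?D" using D by blast
      then show ?thesis using False by (simp add: flip_def)
    qed
    then have "w' = flip i w" by (simp add: vec_eq_iff)
    then show False using flip_odd_vertices [OF assms(1)] odd_vertices_not_Psi [OF assms(2)] by simp
  qed
  moreover have "i \<in> ?D" using i by simp
  ultimately obtain j where j: "j \<in> ?D" "j \<noteq> i" by blast
  have "card {i, j} \<le> card ?D" using i j by (intro card_mono) auto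
  then have "2 \<le> card ?D" using j by simp
  moreover have "card {i. w $ i = w' $ i} + card ?D = CARD('n)"
    by (subst card_Un_disjoint [symmetric]) (auto intro: arg_cong [where f = card])
  ultimately show ?thesis by linarith
qed

text \<open>In \<open>w \<bullet> x + w' \<bullet> x\<close> the coordinates in which \<open>w\<close> and \<open>w'\<close> differ cancel, and every other one
  contributes at most \<open>2\<close>. Consequently distinct corners of the cube meet only in their cutting
  hyperplanes, and a point in two cuts has all its coordinates \<open>\<plusminus>1\<close> where the two vertices agree.\<close>

lemma odd_vertices_inner_sum:
  fixes w w' :: "real ^ 'n::finite"
  assumes w: "w \<in> odd_vertices" "w' \<in> odd_vertices" "w \<noteq> w'" and x: "x \<in> cube"
  shows "w \<bullet> x + w' \<bullet> x \<le> 2 * (real CARD('n) - 2)"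
    and "w $ i = w' $ i \<Longrightarrow> \<bar>x $ i\<bar> \<noteq> 1 \<Longrightarrow> w \<bullet> x + w' \<bullet> x < 2 * (real CARD('n) - 2)"
proof -
  let ?f = "\<lambda>i. w $ i * x $ i + w' $ i * x $ i" and ?g = "\<lambda>i. if w $ i = w' $ i then 2 else (0::real)"
  have sv: "w \<in> sign_vectors" "w' \<in> sign_vectors" using w odd_vertices_sign by auto
  have le: "?f i \<le> ?g i" for i
  proof (cases "w $ i = w' $ i")
    case True
    then show ?thesis using sign_mult_le [OF sv(1) x, of i] by simp
  next
    case False
    then have "w' $ i = - w $ i" using sv by (auto simp: sign_vectors_def dest!: spec [of _ i])
    then show ?thesis using False by simp
  qed
  have f: "w \<bullet> x + w' \<bullet> x = sum ?f UNIV" by (simp add: inner_cart sum.distrib)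
  have "sum ?g UNIV = 2 * real (card {i. w $ i = w' $ i})"
    by (simp add: sum.If_cases)
  then have g: "sum ?g UNIV \<le> 2 * (real CARD('n) - 2)"
    using odd_vertices_agree_card [OF w] by simp
  show "w \<bullet> x + w' \<bullet> x \<le> 2 * (real CARD('n) - 2)"
    unfolding f using sum_mono [of UNIV ?f ?g] le g by simp
  show "w \<bullet> x + w' \<bullet> x < 2 * (real CARD('n) - 2)" if i: "w $ i = w' $ i" "\<bar>x $ i\<bar> \<noteq> 1"
  proof -
    have "\<bar>w $ i * x $ i\<bar> < 1"
      using x i(2) sign_vector_abs [OF sv(1), of i] by (auto simp: abs_mult cube_def less_le)
    then have "?f i < ?g i" using i by simp
    then have "sum ?f UNIV < sum ?g UNIV" using le by (intro sum_strict_mono_ex1 bexI [of _ i]) auto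
    then show ?thesis unfolding f using g by simp
  qed
qed

definition truncated_cube :: "(real ^ 'n::finite) set" where
  "truncated_cube = {x \<in> cube. \<forall>w \<in> odd_vertices. w \<bullet> x \<le> real CARD('n) - 2}"

lemma truncated_cube_Int:
  "truncated_cube = (cube :: (real ^ 'n::finite) set) \<inter> (\<Inter>w\<in>odd_vertices. {x. w \<bullet> x \<le> real CARD('n) - 2})"
  by (auto simp: truncated_cube_def)

lemma compact_truncated_cube: "compact (truncated_cube :: (real ^ 'n::finite) set)"
  unfolding truncated_cube_Int by (intro compact_Int_closed compact_cube closed_INT ballI closed_halfspace_le)

lemma convex_truncated_cube: "convex (truncated_cube :: (real ^ 'n::finite) set)"
  unfolding truncated_cube_Int by (intro convex_Int convex_cube convex_INT convex_halfspace_le)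

lemma sign_vectors_cube: "v \<in> sign_vectors \<Longrightarrow> v \<in> cube"
  by (simp add: cube_def sign_vector_abs)

lemma Psi_subset_truncated_cube: "Psi \<subseteq> (truncated_cube :: (real ^ 'n::finite) set)"
proof
  fix v :: "real ^ 'n" assume v: "v \<in> Psi"
  then have sv: "v \<in> sign_vectors" by (simp add: Psi_eq)
  have "w \<bullet> v \<le> real CARD('n) - 2" if w: "w \<in> odd_vertices" for w
  proof -
    have "w \<in> sign_vectors" by (rule odd_vertices_sign [OF w])
    obtain i where i: "w $ i \<noteq> v $ i" using w v odd_vertices_not_Psi by (metis vec_eq_iff)
    then have "w $ i * v $ i = -1"
      using sv \<open>w \<in> sign_vectors\<close> by (auto simp: sign_vectors_def dest!: spec [of _ i])
    then have "w \<bullet> v = -1 + (\<Sum>j\<in>UNIV - {i}. w $ j * v $ j)"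
      by (simp add: inner_cart sum.remove [of UNIV i])
    also have "\<dots> \<le> -1 + (\<Sum>j\<in>UNIV - {i}. 1)"
      by (intro add_left_mono sum_mono sign_mult_le \<open>w \<in> sign_vectors\<close> sign_vectors_cube sv)
    also have "\<dots> = real CARD('n) - 2"
      by (simp add: card_Diff_singleton of_nat_diff)
    finally show ?thesis .
  qed
  then show "v \<in> truncated_cube" using sv sign_vectors_cube by (simp add: truncated_cube_def)
qed

text \<open>Let \<open>x\<close> be extreme and count its coordinates of absolute value less than \<open>1\<close>. If there is none, \<open>x\<close> is
  a vertex of the cube, and odd vertices are cut off. If there is just one, the odd one of the two
  endpoints of the edge through \<open>x\<close> cuts \<open>x\<close> off. If there are two, \<open>i\<close> and \<open>j\<close>, then \<open>x\<close> can be moved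
  both ways along \<open>w\<^sub>i e\<^sub>i - w\<^sub>j e\<^sub>j\<close>, where \<open>w\<close> is an odd vertex whose inequality is tight at \<open>x\<close>:
  by \<open>odd_vertices_inner_sum\<close> every other tight vertex has the opposite cell_centers at \<open>i\<close> and \<open>j\<close>, so all
  tight inequalities stay tight, and the others have slack.\<close>

lemma extreme_point_truncated_cube:
  fixes x :: "real ^ 'n::finite"
  assumes "x extreme_point_of truncated_cube"
  shows "x \<in> Psi"
proof -
  have xP: "x \<in> truncated_cube" and noseg: "\<And>a b. a \<in> truncated_cube \<Longrightarrow> b \<in> truncated_cube \<Longrightarrow> x \<notin> open_segment a b"
    using assms by (auto simp: extreme_point_of_def)
  then have x: "x \<in> cube" and xw: "\<And>w. w \<in> odd_vertices \<Longrightarrow> w \<bullet> x \<le> real CARD('n) - 2"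
    by (auto simp: truncated_cube_def)
  let ?S = "{i. \<bar>x $ i\<bar> \<noteq> 1}"
  consider "?S = {}" | i where "?S = {i}" | i j where "i \<in> ?S" "j \<in> ?S" "i \<noteq> j" by blast
  then show ?thesis
  proof cases
    case 1
    then have sv: "x \<in> sign_vectors" by (auto simp: sign_vectors_def abs_eq_iff') 
    moreover have "x \<notin> odd_vertices"
    proof
      assume "x \<in> odd_vertices"
      then have "x \<bullet> x \<le> real CARD('n) - 2" by (rule xw)
      then show False using sv by (simp add: inner_cart sign_vector_mult_self)
    qed
    ultimately show ?thesis using sign_vectors_cases by blast
  next
    case (2 i)
    define v where "v = (\<chi> j. if j = i then 1 else x $ j)"
    have xj: "\<bar>x $ j\<bar> = 1" if "j \<noteq> i" for j using 2 that by blast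
    have v: "v \<in> sign_vectors" using xj by (auto simp: v_def sign_vectors_def abs_eq_iff')
    obtain w where w: "w \<in> odd_vertices" "\<And>j. j \<noteq> i \<Longrightarrow> w $ j = x $ j"
    proof (cases "v \<in> odd_vertices")
      case True
      then show ?thesis using that by (simp add: v_def)
    next
      case False
      then have "flip i v \<in> odd_vertices" using v sign_vectors_cases flip_Psi by blast
      then show ?thesis by (rule that) (simp add: flip_def v_def)
    qed
    have "w $ j * x $ j = 1" if "j \<noteq> i" for j
      using w(2)[OF that] sign_vector_mult_self [OF odd_vertices_sign [OF w(1)], of j] by simp
    then have "w \<bullet> x = w $ i * x $ i + (\<Sum>j\<in>UNIV - {i}. 1)"
      by (simp add: inner_cart sum.remove [of UNIV i])
    also have "\<dots> = w $ i * x $ i + real CARD('n) - 1"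
      by (simp add: card_Diff_singleton of_nat_diff)
    finally have "w $ i * x $ i \<le> -1" using xw [OF w(1)] by simp
    then have "1 \<le> \<bar>w $ i * x $ i\<bar>" by linarith
    then have "1 \<le> \<bar>x $ i\<bar>" using sign_vector_abs [OF odd_vertices_sign [OF w(1)], of i] by (simp add: abs_mult)
    moreover have "\<bar>x $ i\<bar> \<le> 1" using x by (simp add: cube_def)
    moreover have "\<bar>x $ i\<bar> \<noteq> 1" using 2 by blast
    ultimately show ?thesis by linarith
  next
    case (3 i j)
    \<comment> \<open>If no inequality is tight, any sign vector serves as \<open>w\<close>.\<close>
    obtain w where w: "w \<in> sign_vectors"
      and tight: "\<And>w'. w' \<in> odd_vertices \<Longrightarrow> w' \<bullet> x = real CARD('n) - 2 \<Longrightarrow>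
        w' = w \<or> w' $ i = - w $ i \<and> w' $ j = - w $ j"
    proof (cases "\<exists>w \<in> odd_vertices. w \<bullet> x = real CARD('n) - 2")
      case True
      then obtain w where w: "w \<in> odd_vertices" "w \<bullet> x = real CARD('n) - 2" by blast
      have "w' $ l = - w $ l" if w': "w' \<in> odd_vertices" "w' \<bullet> x = real CARD('n) - 2" "w' \<noteq> w" and l: "l \<in> ?S" for w' l
      proof -
        have "w $ l \<noteq> w' $ l"
        proof
          assume eq: "w $ l = w' $ l"
          from odd_vertices_inner_sum(2) [OF w(1) w'(1) not_sym [OF w'(3)] x eq] l w(2) w'(2) show False by simp
        qed
        moreover have "w \<in> sign_vectors" "w' \<in> sign_vectors" using w w' odd_vertices_sign by auto
        ultimately show ?thesis by (auto simp: sign_vectors_def dest!: spec [of _ l])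
      qed
      then show ?thesis using that [of w] w odd_vertices_sign 3 by blast
    next
      case False
      have "1 \<in> (sign_vectors :: (real ^ 'n) set)" by (simp add: sign_vectors_def)
      then show ?thesis using that False by blast
    qed
    define d where "d = (\<chi> l. if l = i then w $ i else if l = j then - w $ j else 0)"
    have wd: "w' \<bullet> d = w' $ i * w $ i - w' $ j * w $ j" for w'
    proof -
      have "w' \<bullet> d = (\<Sum>l\<in>{i, j}. w' $ l * d $ l)"
        unfolding inner_cart by (rule sum.mono_neutral_right) (auto simp: d_def)
      then show ?thesis using \<open>i \<noteq> j\<close> by (simp add: d_def)
    qed
    have "d \<noteq> 0"
      using sign_vector_abs [OF w, of i] by (auto simp: d_def vec_eq_iff dest!: spec [of _ i])
    have lim: "((\<lambda>t. x + t *\<^sub>R d) \<longlongrightarrow> x) (nhds 0)"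
      using tendsto_add [OF tendsto_const tendsto_scaleR [OF filterlim_ident tendsto_const], of x d 0] by simp
    have "\<forall>\<^sub>F t in nhds 0. \<bar>(x + t *\<^sub>R d) $ l\<bar> \<le> 1" for l
    proof (cases "l \<in> ?S")
      case True
      then have "\<bar>x $ l\<bar> < 1" using x by (auto simp: cube_def less_le)
      moreover have "((\<lambda>t. \<bar>(x + t *\<^sub>R d) $ l\<bar>) \<longlongrightarrow> \<bar>x $ l\<bar>) (nhds 0)"
        by (intro tendsto_rabs tendsto_vec_nth lim)
      ultimately have "\<forall>\<^sub>F t in nhds 0. \<bar>(x + t *\<^sub>R d) $ l\<bar> < 1" by (rule order_tendstoD(2) [rotated])
      then show ?thesis by eventually_elim simp
    next
      case False
      then have "d $ l = 0" using 3 by (auto simp: d_def)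
      then show ?thesis using x by (simp add: cube_def)
    qed
    then have 1: "\<forall>\<^sub>F t in nhds 0. \<forall>l. \<bar>(x + t *\<^sub>R d) $ l\<bar> \<le> 1"
      using eventually_ball_finite [of UNIV "\<lambda>t l. \<bar>(x + t *\<^sub>R d) $ l\<bar> \<le> 1" "nhds 0"] by simp
    have "\<forall>\<^sub>F t in nhds 0. w' \<bullet> (x + t *\<^sub>R d) \<le> real CARD('n) - 2" if w': "w' \<in> odd_vertices" for w'
    proof (cases "w' \<bullet> x = real CARD('n) - 2")
      case True
      then have "w' \<bullet> d = 0"
        using tight [OF w' True] sign_vector_mult_self [OF w] by (auto simp: wd)
      then show ?thesis using True by (simp add: inner_add_right)
    next
      case False
      then have "w' \<bullet> x < real CARD('n) - 2" using xw [OF w'] by simp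
      moreover have "((\<lambda>t. w' \<bullet> (x + t *\<^sub>R d)) \<longlongrightarrow> w' \<bullet> x) (nhds 0)"
        by (intro tendsto_inner tendsto_const lim)
      ultimately have "\<forall>\<^sub>F t in nhds 0. w' \<bullet> (x + t *\<^sub>R d) < real CARD('n) - 2" by (rule order_tendstoD(2) [rotated])
      then show ?thesis by eventually_elim simp
    qed
    then have 2: "\<forall>\<^sub>F t in nhds 0. \<forall>w'\<in>odd_vertices. w' \<bullet> (x + t *\<^sub>R d) \<le> real CARD('n) - 2"
      by (intro eventually_ball_finite finite_odd_vertices) auto
    from 1 2 have "\<forall>\<^sub>F t in nhds 0. x + t *\<^sub>R d \<in> truncated_cube"
      by eventually_elim (simp add: truncated_cube_def cube_def)
    then obtain e where e: "e > 0" "\<And>t. \<bar>t\<bar> < e \<Longrightarrow> x + t *\<^sub>R d \<in> truncated_cube"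
      unfolding eventually_nhds_metric dist_real_def by auto
    let ?a = "x + (e/2) *\<^sub>R d" and ?b = "x + (- e/2) *\<^sub>R d"
    have "?a \<in> truncated_cube" "?b \<in> truncated_cube" using e(1) by (auto intro!: e(2) simp del: scaleR_minus_left)
    moreover have "x \<in> open_segment ?a ?b"
    proof -
      have "x = midpoint ?a ?b" by (simp add: midpoint_def vec_eq_iff)
      moreover have "?a \<noteq> ?b" using e(1) \<open>d \<noteq> 0\<close> by (auto simp: vec_eq_iff)
      ultimately show ?thesis by (metis midpoint_in_open_segment)
    qed
    ultimately show ?thesis using noseg by blast
  qed
qed

lemma half_cube_eq: "half_cube = (truncated_cube :: (real ^ 'n::finite) set)"
proof
  show "half_cube \<subseteq> (truncated_cube :: (real ^ 'n) set)"
    unfolding half_cube_def by (intro hull_minimal Psi_subset_truncated_cube convex_truncated_cube)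
  have "truncated_cube = convex hull {x :: real ^ 'n. x extreme_point_of truncated_cube}"
    by (rule Krein_Milman_Minkowski [OF compact_truncated_cube convex_truncated_cube])
  also have "\<dots> \<subseteq> half_cube"
    unfolding half_cube_def by (rule hull_mono) (use extreme_point_truncated_cube in auto)
  finally show "(truncated_cube :: (real ^ 'n) set) \<subseteq> half_cube" .
qed

section \<open>Faces of the half cube\<close>

text \<open>Take a face of least dimension containing the point: if the point were on the relative boundary,
  it would lie in a facet of that face.\<close>

lemma polytope_point_in_face_rel_interior:
  fixes P :: "'a::euclidean_space set"
  assumes "polytope P" "x \<in> P"
  obtains F where "F face_of P" "x \<in> rel_interior F"
proof -
  let ?m = "\<lambda>F :: 'a set. nat (aff_dim F + 1)"
  have "P face_of P \<and> x \<in> P" using assms by (simp add: face_of_refl polytope_imp_convex)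
  then obtain F where F: "F face_of P" "x \<in> F"
    and least: "\<And>G. G face_of P \<Longrightarrow> x \<in> G \<Longrightarrow> ?m F \<le> ?m G"
    using ex_has_least_nat [of "\<lambda>F. F face_of P \<and> x \<in> F" P ?m] by blast
  have "x \<in> rel_interior F"
  proof (rule ccontr)
    assume "x \<notin> rel_interior F"
    moreover have "polyhedron F"
      using assms F face_of_polytope_polytope polytope_imp_polyhedron by blast
    ultimately obtain G where G: "G facet_of F" "x \<in> G"
      using rel_boundary_of_polyhedron [of F] F(2) by blast
    then have "?m F \<le> ?m G" using F facet_of_imp_face_of face_of_trans least by blast
    moreover have "aff_dim F \<ge> 0" using F(2) by (metis aff_dim_negative_iff empty_iff not_less)
    ultimately show False using G(1) by (simp add: facet_of_def)
  qed
  then show thesis using that F by blast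
qed

lemma flip_flip_nth:
  assumes "i \<noteq> j"
  shows "flip i (flip j v) $ l = (if l = i \<or> l = j then - v $ l else v $ l)"
  using assms by (auto simp: flip_def)

lemma flip_flip_L:
  assumes "v \<in> Psi" "i \<in> S" "j \<in> S"
  shows "flip i (flip j v) \<in> L v S"
  using assms flip_Psi [of v j] flip_odd_vertices by (auto simp: L_def flip_def)

lemma L_self: "v \<in> Psi \<Longrightarrow> v \<in> L v S"
  by (simp add: L_def)

text \<open>An inequality that is tight at a relative interior point of a face is tight on the whole face.
  The face spanned by \<open>L v S\<close> contains \<open>v\<close> and all points obtained from \<open>v\<close> by changing two cell_centers in \<open>S\<close>.
  Hence no coordinate in \<open>S\<close> is constant on it. If the face lay in the cut at \<open>w\<close>, then changing the cell_centers at
  two places \<open>a\<close> and \<open>b\<close> would preserve \<open>w \<bullet> v\<close>, so the products \<open>w\<^sub>a v\<^sub>a\<close> and \<open>w\<^sub>b v\<^sub>b\<close> would have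
  opposite cell_centers; this is impossible for three places pairwise.\<close>

lemma half_cube_face_interior_point:
  fixes v :: "real ^ 'n::finite"
  assumes v: "v \<in> Psi" and S: "3 \<le> card S"
    and F: "convex hull (L v S) face_of truncated_cube" and x: "x \<in> rel_interior (convex hull (L v S))"
  shows "i \<in> S \<Longrightarrow> \<bar>x $ i\<bar> < 1"
    and "w \<in> odd_vertices \<Longrightarrow> w \<bullet> x < real CARD('n) - 2"
proof -
  let ?F = "convex hull (L v S)"
  have F_sub: "?F \<subseteq> truncated_cube" using F face_of_imp_subset by blast
  have xF: "x \<in> ?F" using x rel_interior_subset by blast
  have sv: "v \<in> sign_vectors" using v by (simp add: Psi_eq)
  have supporting: "a \<bullet> y = b" if le: "\<And>y. y \<in> ?F \<Longrightarrow> a \<bullet> y \<le> b" and eq: "a \<bullet> x = b" and y: "y \<in> L v S" for a b y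
  proof -
    have face: "?F \<inter> {y. a \<bullet> y = b} face_of ?F"
      by (intro face_of_Int_supporting_hyperplane_le convex_convex_hull le)
    have "?F \<inter> {y. a \<bullet> y = b} \<inter> rel_interior ?F \<noteq> {}" using eq x xF by blast
    then have "?F \<subseteq> ?F \<inter> {y. a \<bullet> y = b}"
      by (rule subset_of_face_of [OF face order_refl])
    moreover have "y \<in> ?F" by (rule hull_inc [OF y])
    ultimately show ?thesis by blast
  qed
  show "\<bar>x $ i\<bar> < 1" if i: "i \<in> S"
  proof (rule ccontr)
    assume "\<not> \<bar>x $ i\<bar> < 1"
    then have xi: "x $ i = 1 \<or> x $ i = -1"
      using xF F_sub by (auto simp: truncated_cube_def cube_def dest!: subsetD spec [of _ i])
    have "S \<noteq> {i}" using S by auto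
    then obtain j where j: "j \<in> S" "j \<noteq> i" using i by blast
    have in_F: "axis i (x $ i) \<bullet> y \<le> 1" if "y \<in> ?F" for y
    proof -
      have "\<bar>y $ i\<bar> \<le> 1" using that F_sub by (auto simp: truncated_cube_def cube_def)
      then show ?thesis using xi by (auto simp: inner_axis')
    qed
    have eq: "axis i (x $ i) \<bullet> x = 1" using xi by (auto simp: inner_axis')
    have "x $ i * v $ i = 1" "x $ i * flip i (flip j v) $ i = 1"
      using supporting [OF in_F eq L_self [OF v]] supporting [OF in_F eq flip_flip_L [OF v i j(1)]]
      by (simp_all add: inner_axis')
    then show False using j by (simp add: flip_flip_nth)
  qed
  show "w \<bullet> x < real CARD('n) - 2" if w: "w \<in> odd_vertices"
  proof (rule ccontr)
    have le: "w \<bullet> y \<le> real CARD('n) - 2" if "y \<in> ?F" for y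
      using that F_sub w by (auto simp: truncated_cube_def)
    assume "\<not> w \<bullet> x < real CARD('n) - 2"
    then have eq: "w \<bullet> x = real CARD('n) - 2" using le [OF xF] by simp
    obtain i j l where ijl: "i \<in> S" "j \<in> S" "l \<in> S" "i \<noteq> j" "j \<noteq> l" "i \<noteq> l"
    proof -
      obtain T where "T \<subseteq> S" "card T = 3" using S by (metis obtain_subset_with_card_n)
      then show thesis using that by (auto simp: card_3_iff)
    qed
    have diff: "w $ a * v $ a + w $ b * v $ b = 0" if ab: "a \<in> S" "b \<in> S" "a \<noteq> b" for a b
    proof -
      have "w \<bullet> v = real CARD('n) - 2" "w \<bullet> flip a (flip b v) = real CARD('n) - 2"
        using supporting [OF le eq] L_self [OF v] flip_flip_L [OF v ab(1,2)] by auto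
      then have "0 = w \<bullet> (v - flip a (flip b v))" by (simp add: inner_diff_right)
      also have "\<dots> = (\<Sum>m\<in>{a, b}. w $ m * (v - flip a (flip b v)) $ m)"
        unfolding inner_cart by (rule sum.mono_neutral_right) (auto simp: flip_flip_nth ab(3))
      also have "\<dots> = 2 * (w $ a * v $ a + w $ b * v $ b)"
        using ab(3) by (simp add: flip_flip_nth algebra_simps)
      finally show ?thesis by simp
    qed
    have "w $ i * v $ i = 0"
      using diff [of i j] diff [of j l] diff [of i l] ijl by linarith
    then show False
      using sign_vector_abs [OF sv, of i] sign_vector_abs [OF odd_vertices_sign [OF w], of i] by auto
  qed
qed

text \<open>Away from the cutting hyperplanes the half cube looks like the cube: the trace of the face of the
  cube whose relative interior contains \<open>x\<close> is a face of the half cube with \<open>x\<close> in its relative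
  interior, and as a face of the convex hull of \<open>Psi\<close> it is spanned by the points of \<open>Psi\<close> it contains.\<close>

lemma half_cube_face_at:
  fixes x :: "real ^ 'n::finite"
  assumes x: "x \<in> truncated_cube" and strict: "\<And>w. w \<in> odd_vertices \<Longrightarrow> w \<bullet> x < real CARD('n) - 2"
  obtains v where "v \<in> Psi" "convex hull (L v {i. \<bar>x $ i\<bar> \<noteq> 1}) face_of truncated_cube"
    "x \<in> rel_interior (convex hull (L v {i. \<bar>x $ i\<bar> \<noteq> 1}))"
proof -
  let ?S = "{i. \<bar>x $ i\<bar> \<noteq> 1}"
  \<comment> \<open>\<open>A\<close> is the affine hull of the face of the cube whose relative interior contains \<open>x\<close>.\<close>
  define A where "A = {y :: real ^ 'n. \<forall>i. i \<notin> ?S \<longrightarrow> y $ i = x $ i}"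
  define G where "G = truncated_cube \<inter> A"
  have xc: "x \<in> cube" using x by (simp add: truncated_cube_def)
  have xG: "x \<in> G" using x by (simp add: G_def A_def)
  have A_affine: "affine A"
    by (auto simp: affine_def A_def simp flip: distrib_right)
  have face: "G face_of truncated_cube"
    unfolding face_of_def
  proof (intro conjI ballI impI)
    show "convex G" unfolding G_def by (intro convex_Int convex_truncated_cube affine_imp_convex A_affine)
    show "G \<subseteq> truncated_cube" by (simp add: G_def)
    fix a b y assume ab: "a \<in> truncated_cube" "b \<in> truncated_cube" and y: "y \<in> G" "y \<in> open_segment a b"
    obtain u where u: "0 < u" "u < 1" "y = (1 - u) *\<^sub>R a + u *\<^sub>R b" using y(2) by (auto simp: in_segment)
    have "a $ i = x $ i \<and> b $ i = x $ i" if i: "i \<notin> ?S" for i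
    proof -
      have yi: "(1 - u) * a $ i + u * b $ i = x $ i" using y(1) i u(3) by (simp add: G_def A_def)
      have le: "x $ i * a $ i \<le> 1" "x $ i * b $ i \<le> 1"
      proof -
        have "\<bar>a $ i\<bar> \<le> 1" "\<bar>b $ i\<bar> \<le> 1" "\<bar>x $ i\<bar> = 1"
          using ab i by (auto simp: truncated_cube_def cube_def)
        then show "x $ i * a $ i \<le> 1" "x $ i * b $ i \<le> 1" by (auto simp: abs_eq_iff')
      qed
      \<comment> \<open>The coordinate \<open>x\<^sub>i = \<plusminus>1\<close> is extremal, and only the endpoints of a segment can average to it.\<close>
      have xx: "x $ i * x $ i = 1" using i by (auto simp: abs_eq_iff')
      have "(1 - u) * (1 - x $ i * a $ i) + u * (1 - x $ i * b $ i) = 1 - x $ i * ((1 - u) * a $ i + u * b $ i)"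
        by (simp add: algebra_simps)
      also have "\<dots> = 0" using yi xx by simp
      finally have "(1 - u) * (1 - x $ i * a $ i) + u * (1 - x $ i * b $ i) = 0" .
      then have "(1 - u) * (1 - x $ i * a $ i) = 0 \<and> u * (1 - x $ i * b $ i) = 0"
        using u le by (subst (asm) add_nonneg_eq_0_iff) auto
      then have "x $ i * a $ i = 1" "x $ i * b $ i = 1" using u by auto
      then show ?thesis using xx i by (auto simp: abs_eq_iff')
    qed
    then show "a \<in> G" "b \<in> G" using ab by (auto simp: G_def A_def)
  qed
  have "x \<in> rel_interior G"
    unfolding mem_rel_interior
  proof (intro exI conjI)
    let ?T = "(\<Inter>i\<in>?S. {y. \<bar>y $ i\<bar> < 1}) \<inter> (\<Inter>w\<in>odd_vertices. {y :: real ^ 'n. w \<bullet> y < real CARD('n) - 2})"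
    have "open {y :: real ^ 'n. \<bar>y $ i\<bar> < 1}" for i
      by (intro open_Collect_less continuous_intros)
    then show "open ?T"
      by (intro open_Int open_INT ballI open_halfspace_lt finite_odd_vertices) auto
    show "x \<in> ?T \<inter> G"
      using xG xc strict by (auto simp: cube_def less_le)
    have "affine hull G \<subseteq> A" by (intro hull_minimal A_affine) (simp add: G_def)
    moreover have "?T \<inter> A \<subseteq> G"
    proof
      fix y assume y: "y \<in> ?T \<inter> A"
      have "\<bar>y $ i\<bar> \<le> 1" for i
      proof (cases "i \<in> ?S")
        case True
        then show ?thesis using y by (auto intro: less_imp_le)
      next
        case False
        then show ?thesis using y by (simp add: A_def)
      qed
      then show "y \<in> G" using y by (auto simp: G_def truncated_cube_def cube_def intro: less_imp_le)
    qed
    ultimately show "?T \<inter> affine hull G \<subseteq> G" by blast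
  qed
  moreover obtain V where V: "V \<subseteq> Psi" "G = convex hull V"
    using face_of_convex_hull_subset [of Psi G] face finite_Psi finite_imp_compact half_cube_eq
    unfolding half_cube_def by metis
  have "V \<noteq> {}" using V(2) xG by auto
  then obtain v where "v \<in> V" by blast
  have VA: "V \<subseteq> A" using V(2) hull_subset [of V convex] by (auto simp: G_def)
  have "V \<subseteq> L v ?S" using V(1) VA \<open>v \<in> V\<close> by (auto simp: L_def A_def subset_iff)
  moreover have "L v ?S \<subseteq> G"
    using Psi_subset_truncated_cube VA \<open>v \<in> V\<close> by (auto simp: L_def A_def G_def)
  ultimately have "G = convex hull (L v ?S)"
    using V(2) face_of_imp_convex [OF face] by (metis antisym hull_minimal hull_mono)
  moreover have "v \<in> Psi" using V(1) \<open>v \<in> V\<close> by blast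
  ultimately show thesis using that face \<open>x \<in> rel_interior G\<close> by simp
qed

text \<open>A point lies in the relative interior of only one face, so the two preceding lemmas decide from a
  point alone whether the face through it is half cube shaped.\<close>

lemma half_cube_shaped_iff:
  fixes x :: "real ^ 'n::finite"
  assumes F: "F face_of truncated_cube" and x: "x \<in> rel_interior F" and k: "3 \<le> k"
  shows "(\<exists>v \<in> Psi. \<exists>S. card S \<ge> k \<and> F = convex hull (L v S)) \<longleftrightarrow>
    k \<le> card {i. \<bar>x $ i\<bar> \<noteq> 1} \<and> (\<forall>w \<in> odd_vertices. w \<bullet> x < real CARD('n) - 2)"
    (is "?lhs \<longleftrightarrow> ?rhs")
proof
  assume ?lhs
  then obtain v S where v: "v \<in> Psi" "k \<le> card S" "F = convex hull (L v S)" by blast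
  have "3 \<le> card S" using v(2) k by simp
  note int = half_cube_face_interior_point [OF v(1) this F[unfolded v(3)] x[unfolded v(3)]]
  have "S \<subseteq> {i. \<bar>x $ i\<bar> \<noteq> 1}" using int(1) by fastforce
  then have "card S \<le> card {i. \<bar>x $ i\<bar> \<noteq> 1}" by (intro card_mono) auto
  then show ?rhs using int(2) v(2) by simp
next
  assume r: ?rhs
  have "x \<in> truncated_cube" using F x rel_interior_subset face_of_imp_subset by blast
  then obtain v where v: "v \<in> Psi" "convex hull (L v {i. \<bar>x $ i\<bar> \<noteq> 1}) face_of truncated_cube"
    "x \<in> rel_interior (convex hull (L v {i. \<bar>x $ i\<bar> \<noteq> 1}))"
    using half_cube_face_at r by metis
  have "F = convex hull (L v {i. \<bar>x $ i\<bar> \<noteq> 1})"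
    using face_of_eq [OF F v(2)] x v(3) by blast
  then show ?lhs using v(1) r by blast
qed

lemma polytope_truncated_cube: "polytope (truncated_cube :: (real ^ 'n::finite) set)"
  unfolding half_cube_eq [symmetric] half_cube_def polytope_def using finite_Psi by blast

text \<open>Vertices and the interior of the half cube are relative interiors of faces as well, so the cells
  are governed by \<open>half_cube_shaped_iff\<close>. The half cube itself is half cube shaped because \<open>k \<le> n\<close>;
  this excludes the only face not of dimension less than \<open>n\<close>.\<close>

lemma union_cells_without:
  assumes k: "3 \<le> k" "k \<le> CARD('n::finite)"
  shows "\<Union> (cells_without k) = {x :: real ^ 'n. x \<in> truncated_cube \<and>
    (card {i. \<bar>x $ i\<bar> \<noteq> 1} < k \<or> (\<exists>w \<in> odd_vertices. w \<bullet> x = real CARD('n) - 2))}" (is "_ = ?R")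
proof
  let ?shaped = "\<lambda>F :: (real ^ 'n) set. \<exists>v \<in> Psi. \<exists>S. card S \<ge> k \<and> F = convex hull (L v S)"
  have R: "x \<in> ?R \<longleftrightarrow> \<not> ?shaped F" if F: "F face_of truncated_cube" "x \<in> rel_interior F" for x F
  proof -
    have "x \<in> truncated_cube" using F rel_interior_subset face_of_imp_subset by blast
    moreover then have "w \<bullet> x = real CARD('n) - 2 \<longleftrightarrow> \<not> w \<bullet> x < real CARD('n) - 2" if "w \<in> odd_vertices" for w
      using that by (auto simp: truncated_cube_def)
    ultimately show ?thesis
      unfolding half_cube_shaped_iff [OF F k(1)] by (auto simp: not_le)
  qed
  have closure: "closure (rel_interior F) = F" if "F face_of (truncated_cube :: (real ^ 'n) set)" for F
    using that compact_truncated_cube convex_truncated_cube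
    by (metis closure_closed compact_imp_closed convex_closure_rel_interior face_of_imp_compact face_of_imp_convex)
  show "\<Union> (cells_without k) \<subseteq> ?R"
  proof
    fix x :: "real ^ 'n" assume "x \<in> \<Union> (cells_without k)"
    then obtain e where e: "e \<in> half_cube_cells" "\<not> ?shaped (closure e)" "x \<in> e"
      by (auto simp: cells_without_def)
    have "\<exists>F. F face_of truncated_cube \<and> e = rel_interior F"
      using e(1) unfolding half_cube_cells_def half_cube_eq
    proof (elim UnE CollectE exE conjE)
      fix v :: "real ^ 'n" assume "e = {v}" "v extreme_point_of truncated_cube"
      then show ?thesis by (intro exI [of _ "{v}"]) (simp add: face_of_singleton)
    next
      assume "e \<in> {interior truncated_cube}"
      then have "e = rel_interior truncated_cube"
        using e(3) rel_interior_nonempty_interior by blast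
      then show ?thesis using face_of_refl [OF convex_truncated_cube] by blast
    qed blast
    then obtain F where F: "F face_of truncated_cube" "e = rel_interior F" by blast
    then have "\<not> ?shaped F" using closure [OF F(1)] e(2) by simp
    then show "x \<in> ?R" using R [OF F(1), of x] F(2) e(3) by blast
  qed
  show "?R \<subseteq> \<Union> (cells_without k)"
  proof
    fix x :: "real ^ 'n" assume x: "x \<in> ?R"
    then obtain F where F: "F face_of truncated_cube" "x \<in> rel_interior F"
      using polytope_point_in_face_rel_interior [OF polytope_truncated_cube] by blast
    then have not_shaped: "\<not> ?shaped F" using R x by blast
    have "F \<noteq> truncated_cube"
    proof
      assume "F = truncated_cube"
      moreover have "1 \<in> (Psi :: (real ^ 'n) set)" by (simp add: Psi_def)
      moreover have "L (1 :: real ^ 'n) UNIV = Psi" by (simp add: L_def)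
      ultimately have "?shaped F" using k(2) half_cube_eq half_cube_def by metis
      then show False using not_shaped by blast
    qed
    then have "aff_dim F < aff_dim (truncated_cube :: (real ^ 'n) set)"
      by (intro face_of_aff_dim_lt convex_truncated_cube F)
    also have "\<dots> \<le> int CARD('n)" using aff_dim_le_DIM [of "truncated_cube :: (real ^ 'n) set"] by simp
    finally have lt: "aff_dim F < int CARD('n)" .
    have "x \<in> F" using F(2) rel_interior_subset by blast
    have "rel_interior F \<in> half_cube_cells"
    proof (cases "aff_dim F = 0")
      case True
      then obtain a where "F = {a}" by (auto simp: aff_dim_eq_0)
      then show ?thesis using F(1) by (simp add: half_cube_cells_def half_cube_eq face_of_singleton)
    next
      case False
      moreover have "0 \<le> aff_dim F" using \<open>x \<in> F\<close> by (metis aff_dim_negative_iff empty_iff not_less)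
      ultimately show ?thesis using F(1) lt by (auto simp: half_cube_cells_def half_cube_eq)
    qed
    then have "rel_interior F \<in> cells_without k"
      using not_shaped closure [OF F(1)] by (simp add: cells_without_def)
    then show "x \<in> \<Union> (cells_without k)" using F(2) by blast
  qed
qed

section \<open>Comparison with the skeleton of the cube\<close>

definition corners :: "(real ^ 'n::finite) set" where
  "corners = {x \<in> cube. \<exists>w \<in> odd_vertices. real CARD('n) - 2 \<le> w \<bullet> x}"

lemma inner_sign_vector_self:
  fixes w :: "real ^ 'n::finite"
  shows "w \<in> sign_vectors \<Longrightarrow> w \<bullet> w = real CARD('n)"
  by (simp add: inner_cart sign_vector_mult_self)

lemma closed_segment_corners:
  fixes w :: "real ^ 'n::finite"
  assumes "w \<in> odd_vertices" "x \<in> cube" "y \<in> cube" "real CARD('n) - 2 \<le> w \<bullet> x" "real CARD('n) - 2 \<le> w \<bullet> y"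
  shows "closed_segment x y \<subseteq> corners"
proof -
  have "convex (cube \<inter> {z. w \<bullet> z \<ge> real CARD('n) - 2})"
    by (intro convex_Int convex_cube convex_halfspace_ge)
  then have "closed_segment x y \<subseteq> cube \<inter> {z. w \<bullet> z \<ge> real CARD('n) - 2}"
    using assms by (intro closed_segment_subset) auto
  then show ?thesis using assms(1) by (auto simp: corners_def)
qed

text \<open>Orthogonal projection onto the cut keeps each corner inside the cube: the corner is the simplex
  with vertices \<open>w\<close> and the neighbours of \<open>w\<close>, and the projection sends \<open>w\<close> to the barycentre of the
  neighbours. Distinct corners overlap only in their cuts, where nothing moves.\<close>

lemma homotopy_equivalent_cut_corners:
  fixes k :: nat
  shows "top_of_set (skeleton k \<union> corners :: (real ^ 'n::finite) set) homotopy_equivalent_space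
    top_of_set {x :: real ^ 'n. x \<in> truncated_cube \<and>
      (card {i. \<bar>x $ i\<bar> \<noteq> 1} < k \<or> (\<exists>w \<in> odd_vertices. w \<bullet> x = real CARD('n) - 2))}"
    (is "_ homotopy_equivalent_space top_of_set ?U")
proof -
  let ?n = "real CARD('n)"
  \<comment> \<open>At most one summand is nonzero; the sum gives a formula that is continuous across the corners.\<close>
  define r :: "real ^ 'n \<Rightarrow> real ^ 'n"
    where "r x = x - (\<Sum>w\<in>odd_vertices. (max 0 (w \<bullet> x - (?n - 2)) / ?n) *\<^sub>R w)" for x
  have r_id: "r x = x" if "\<And>w. w \<in> odd_vertices \<Longrightarrow> w \<bullet> x \<le> ?n - 2" for x
  proof -
    have "max 0 (w \<bullet> x - (?n - 2)) = 0" if "w \<in> odd_vertices" for w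
      using \<open>\<And>w. w \<in> odd_vertices \<Longrightarrow> w \<bullet> x \<le> ?n - 2\<close> [OF that] by simp
    then show ?thesis by (simp add: r_def)
  qed
  have r_corner: "r x \<in> truncated_cube \<and> w \<bullet> r x = ?n - 2"
    if w: "w \<in> odd_vertices" and x: "x \<in> cube" "?n - 2 \<le> w \<bullet> x" for w x
  proof -
    define c where "c = (w \<bullet> x - (?n - 2)) / ?n"
    have sv: "w \<in> sign_vectors" by (rule odd_vertices_sign [OF w])
    have other: "w' \<bullet> x \<le> ?n - 2" if "w' \<in> odd_vertices" "w' \<noteq> w" for w'
      using odd_vertices_inner_sum(1) [OF w that(1) not_sym [OF that(2)] x(1)] x(2) by simp
    have "(\<Sum>w\<in>odd_vertices. (max 0 (w \<bullet> x - (?n - 2)) / ?n) *\<^sub>R w) = (\<Sum>w\<in>{w}. (max 0 (w \<bullet> x - (?n - 2)) / ?n) *\<^sub>R w)"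
      using w by (intro sum.mono_neutral_right finite_odd_vertices) (auto simp: max_absorb1 other)
    then have rx: "r x = x - c *\<^sub>R w" using x(2) by (simp add: r_def c_def max_def)
    then have tight: "w \<bullet> r x = ?n - 2"
      by (simp add: inner_diff_right inner_sign_vector_self [OF sv] c_def)
    have "\<bar>r x $ i\<bar> \<le> 1" for i
    proof -
      let ?y = "w $ i * x $ i"
      have "w \<bullet> x = ?y + (\<Sum>j\<in>UNIV - {i}. w $ j * x $ j)"
        by (simp add: inner_cart sum.remove [of UNIV i])
      also have "\<dots> \<le> ?y + (\<Sum>j\<in>UNIV - {i}. 1)"
        by (intro add_left_mono sum_mono sign_mult_le sv x)
      also have "\<dots> = ?y + ?n - 1" by (simp add: card_Diff_singleton of_nat_diff)
      finally have "c * ?n \<le> ?y + 1" by (simp add: c_def)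
      moreover have "0 \<le> c" using x(2) by (simp add: c_def)
      moreover have "c \<le> c * ?n" using \<open>0 \<le> c\<close> by (simp add: mult_le_cancel_left1)
      moreover have "?y \<le> 1" by (rule sign_mult_le [OF sv x(1)])
      ultimately have "\<bar>?y - c\<bar> \<le> 1" by linarith
      moreover have "w $ i * r x $ i = ?y - c"
        using sign_vector_mult_self [OF sv, of i] by (simp add: rx algebra_simps)
      ultimately have "\<bar>w $ i * r x $ i\<bar> \<le> 1" by simp
      then show ?thesis using sign_vector_abs [OF sv, of i] by (simp add: abs_mult)
    qed
    then have cube: "r x \<in> cube" by (simp add: cube_def)
    have "w' \<bullet> r x \<le> ?n - 2" if w': "w' \<in> odd_vertices" for w'
    proof (cases "w' = w")
      case True then show ?thesis using tight by simp
    next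
      case False
      then show ?thesis using odd_vertices_inner_sum(1) [OF w w' not_sym [OF False] cube] tight by simp
    qed
    then show ?thesis using cube tight by (simp add: truncated_cube_def)
  qed
  show ?thesis
  proof (rule homotopy_equivalent_linear_retract)
    show "?U \<subseteq> skeleton k \<union> corners"
      by (fastforce simp: skeleton_def corners_def truncated_cube_def cube_def)
    show "continuous_on (skeleton k \<union> corners) r"
      unfolding r_def by (intro continuous_intros) auto
    show "r x = x" if "x \<in> ?U" for x
      using that by (intro r_id) (auto simp: truncated_cube_def)
    have step: "r x \<in> ?U \<and> closed_segment x (r x) \<subseteq> skeleton k \<union> corners" if x: "x \<in> skeleton k \<union> corners" for x
    proof (cases "x \<in> corners")
      case True
      then obtain w where w: "w \<in> odd_vertices" "x \<in> cube" "?n - 2 \<le> w \<bullet> x" by (auto simp: corners_def)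
      note rx = r_corner [OF this]
      then have "closed_segment x (r x) \<subseteq> corners"
        by (intro closed_segment_corners [OF w(1,2) _ w(3)]) (auto simp: truncated_cube_def)
      then show ?thesis using rx w by blast
    next
      case False
      then have x: "x \<in> skeleton k" using x by blast
      have lt: "w \<bullet> x \<le> ?n - 2" if "w \<in> odd_vertices" for w
        using False that x by (force simp: corners_def skeleton_def cube_def)
      moreover have "r x = x" by (rule r_id [OF lt])
      ultimately show ?thesis using x by (auto simp: skeleton_def cube_def truncated_cube_def cube_def)
    qed
    show "r ` (skeleton k \<union> corners) \<subseteq> ?U" using step by blast
    show "closed_segment x (r x) \<subseteq> skeleton k \<union> corners" if "x \<in> skeleton k \<union> corners" for x
      using step [OF that] by blast
  qed
qed

lemma continuous_on_Max_image:
  fixes f :: "'b \<Rightarrow> 'a::topological_space \<Rightarrow> real"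
  assumes "finite A" "A \<noteq> {}" "\<And>a. a \<in> A \<Longrightarrow> continuous_on S (f a)"
  shows "continuous_on S (\<lambda>x. Max ((\<lambda>a. f a x) ` A))"
  using assms
proof (induction rule: finite_ne_induct)
  case (insert a A)
  then have "(\<lambda>x. Max ((\<lambda>a. f a x) ` insert a A)) = (\<lambda>x. max (f a x) (Max ((\<lambda>a. f a x) ` A)))" by simp
  then show ?case using insert by (simp only:) (intro continuous_on_max; simp)
qed simp

lemma continuous_on_Min_image:
  fixes f :: "'b \<Rightarrow> 'a::topological_space \<Rightarrow> real"
  assumes "finite A" "A \<noteq> {}" "\<And>a. a \<in> A \<Longrightarrow> continuous_on S (f a)"
  shows "continuous_on S (\<lambda>x. Min ((\<lambda>a. f a x) ` A))"
  using assms
proof (induction rule: finite_ne_induct)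
  case (insert a A)
  then have "(\<lambda>x. Min ((\<lambda>a. f a x) ` insert a A)) = (\<lambda>x. min (f a x) (Min ((\<lambda>a. f a x) ` A)))" by simp
  then show ?case using insert by (simp only:) (intro continuous_on_min; simp)
qed simp

text \<open>With \<open>y\<^sub>i = w\<^sub>i x\<^sub>i\<close> the corner at \<open>w\<close> is \<open>\<Sum>\<^sub>i (1 - y\<^sub>i) \<le> 2\<close>; the claim is that expanding
  and clamping does not leave the corner. Expansion moves the nonnegative \<open>y\<^sub>i\<close> towards \<open>1\<close>, which helps.
  At most one \<open>y\<^sub>p\<close> is negative, and the loss there is compensated by the others: the sum of their
  shortfalls below \<open>\<sigma>\<close> is at most \<open>\<sigma> + y\<^sub>p\<close> as soon as one of them is below \<open>\<sigma>\<close>, because that one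
  alone gains \<open>1 - \<sigma>\<close>; and if none is, all of them reach \<open>1\<close>.\<close>

lemma stretch_sum_le:
  fixes y :: "'n::finite \<Rightarrow> real"
  assumes \<sigma>: "0 < \<sigma>" "\<sigma> \<le> 1" and y: "\<And>i. y i \<le> 1" and sum: "(\<Sum>i\<in>UNIV. 1 - y i) \<le> 2"
  shows "(\<Sum>i\<in>UNIV. 1 - max (-1) (min 1 (y i / \<sigma>))) \<le> 2"
proof (cases "\<exists>p. y p < 0")
  case False
  have "1 - max (-1) (min 1 (y i / \<sigma>)) \<le> 1 - y i" for i
  proof -
    have "0 \<le> y i" using False by (simp add: not_less)
    then have "y i \<le> y i / \<sigma>" using \<sigma> by (simp add: le_divide_eq mult_left_le)
    then show ?thesis using y [of i] by simp
  qed
  then have "(\<Sum>i\<in>UNIV. 1 - max (-1) (min 1 (y i / \<sigma>))) \<le> (\<Sum>i\<in>UNIV. 1 - y i)" by (intro sum_mono)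
  then show ?thesis using sum by simp
next
  case True
  then obtain p where p: "y p < 0" by blast
  let ?R = "UNIV - {p}"
  have rest: "(\<Sum>i\<in>?R. 1 - y i) \<le> 1 + y p"
    using sum by (simp add: sum.remove [of UNIV p])
  have nonneg: "0 \<le> 1 - y i" for i using y [of i] by simp
  have y_pos: "0 \<le> y i" if "i \<noteq> p" for i
  proof -
    have "1 - y i \<le> (\<Sum>i\<in>?R. 1 - y i)" using that nonneg by (intro member_le_sum) auto
    then show ?thesis using rest p by simp
  qed
  define e where "e i = max 0 (\<sigma> - y i)" for i
  have e: "1 - max (-1) (min 1 (y i / \<sigma>)) = e i / \<sigma>" if "i \<noteq> p" for i
    using y_pos [OF that] \<sigma> by (auto simp: e_def max_def min_def field_simps)
  have "(\<Sum>i\<in>?R. e i) \<le> max 0 (\<sigma> + y p)"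
  proof (cases "\<exists>q. q \<noteq> p \<and> y q < \<sigma>")
    case False
    then have "(\<Sum>i\<in>?R. e i) = 0" by (intro sum.neutral) (auto simp: e_def not_less)
    then show ?thesis by simp
  next
    case True
    then obtain q where q: "q \<noteq> p" "y q < \<sigma>" by blast
    have "(\<Sum>i\<in>?R. e i) = e q + (\<Sum>i\<in>?R - {q}. e i)" using q by (simp add: sum.remove [of ?R q])
    also have "\<dots> \<le> (\<sigma> - y q) + (\<Sum>i\<in>?R - {q}. 1 - y i)"
      using q \<sigma> nonneg by (intro add_mono sum_mono) (auto simp: e_def)
    also have "\<dots> = (\<sigma> - 1) + (\<Sum>i\<in>?R. 1 - y i)" using q by (simp add: sum.remove [of ?R q])
    also have "\<dots> \<le> \<sigma> + y p" using rest by simp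
    finally show ?thesis by simp
  qed
  then have "(\<Sum>i\<in>?R. e i) / \<sigma> \<le> max 0 (\<sigma> + y p) / \<sigma>" using \<sigma> by (intro divide_right_mono) auto
  moreover have "(\<Sum>i\<in>?R. 1 - max (-1) (min 1 (y i / \<sigma>))) = (\<Sum>i\<in>?R. e i) / \<sigma>"
    by (simp add: sum_divide_distrib e)
  moreover have "1 - max (-1) (min 1 (y p / \<sigma>)) + max 0 (\<sigma> + y p) / \<sigma> = 2"
    using p \<sigma> by (auto simp: max_def min_def field_simps)
  ultimately show ?thesis by (simp add: sum.remove [of UNIV p])
qed

text \<open>Expanding by the factor \<open>1 / (1 - \<tau>)\<close> pushes a coordinate to \<open>\<plusminus>1\<close> exactly when its distance
  \<open>1 - \<bar>x\<^sub>i\<bar>\<close> from the boundary of the cube is at most \<open>\<tau>\<close>. The \<open>(k-1)\<close>-skeleton consists of the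
  points with at least \<open>m = n - k + 1\<close> coordinates \<open>\<plusminus>1\<close>, so \<open>\<tau>\<close> must be the \<open>m\<close>-th smallest of these
  distances. It is less than \<open>1\<close> as long as fewer than \<open>k\<close> coordinates vanish, and it is \<open>0\<close> on the
  skeleton, so points there stay fixed.\<close>

lemma homotopy_equivalent_skeleton:
  assumes k: "3 \<le> k" "k \<le> CARD('n::finite)"
  shows "top_of_set (skeleton k \<union> corners :: (real ^ 'n) set) homotopy_equivalent_space top_of_set (skeleton k :: (real ^ 'n) set)"
proof -
  define m where "m = CARD('n) - k + 1"
  define \<A> where "\<A> = {A :: 'n set. card A = m}"
  have "0 < m" "m \<le> CARD('n)" using k by (auto simp: m_def)
  have A_ne: "A \<noteq> {}" if "A \<in> \<A>" for A using that \<open>0 < m\<close> by (auto simp: \<A>_def)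
  have "\<A> \<noteq> {}" using \<open>m \<le> CARD('n)\<close> by (auto simp: \<A>_def intro: obtain_subset_with_card_n [of m "UNIV :: 'n set"])
  \<comment> \<open>Written as a minimum over \<open>m\<close>-element sets of maxima, the \<open>m\<close>-th smallest distance is visibly continuous.\<close>
  define \<tau> where "\<tau> x = Min ((\<lambda>A. Max ((\<lambda>i. 1 - \<bar>x $ i\<bar>) ` A)) ` \<A>)" for x :: "real ^ 'n"
  have cont_\<tau>: "continuous_on S \<tau>" for S
    unfolding \<tau>_def using A_ne \<open>\<A> \<noteq> {}\<close>
    by (intro continuous_on_Min_image continuous_on_Max_image continuous_intros) auto
  have \<tau>_le: "\<tau> x \<le> c" if c: "m \<le> card {i. 1 - \<bar>x $ i\<bar> \<le> c}" for x c
  proof -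
    obtain A where A: "A \<subseteq> {i. 1 - \<bar>x $ i\<bar> \<le> c}" "card A = m" using c obtain_subset_with_card_n by blast
    then have "A \<in> \<A>" by (simp add: \<A>_def)
    then have "\<tau> x \<le> Max ((\<lambda>i. 1 - \<bar>x $ i\<bar>) ` A)" unfolding \<tau>_def by (intro Min_le) auto
    also have "\<dots> \<le> c" using A(1) A_ne [OF \<open>A \<in> \<A>\<close>] by (intro Max.boundedI) auto
    finally show ?thesis .
  qed
  have \<tau>_set: "\<exists>A. card A = m \<and> (\<forall>i\<in>A. 1 - \<bar>x $ i\<bar> \<le> \<tau> x)" for x
  proof -
    have "\<tau> x \<in> (\<lambda>A. Max ((\<lambda>i. 1 - \<bar>x $ i\<bar>) ` A)) ` \<A>"
      unfolding \<tau>_def using \<open>\<A> \<noteq> {}\<close> by (intro Min_in) auto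
    then obtain A where "A \<in> \<A>" "\<tau> x = Max ((\<lambda>i. 1 - \<bar>x $ i\<bar>) ` A)" by blast
    then show ?thesis by (auto simp: \<A>_def)
  qed
  have \<tau>_ge: "0 \<le> \<tau> x" if x: "x \<in> cube" for x
  proof -
    obtain A where A: "card A = m" "\<forall>i\<in>A. 1 - \<bar>x $ i\<bar> \<le> \<tau> x" using \<tau>_set by blast
    then obtain i where "i \<in> A" using \<open>0 < m\<close> by fastforce
    moreover have "\<bar>x $ i\<bar> \<le> 1" using x by (simp add: cube_def)
    ultimately show ?thesis using A(2) by force
  qed
  have compl: "card {i. P i} + card {i. \<not> P i} = CARD('n)" for P :: "'n \<Rightarrow> bool"
    by (subst card_Un_disjoint [symmetric]) (auto intro: arg_cong [where f = card])
  have skeleton_cube: "skeleton k \<subseteq> (cube :: (real ^ 'n) set)" by (auto simp: skeleton_def cube_def)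
  have \<tau>_skeleton: "\<tau> x = 0" if x: "x \<in> skeleton k" for x
  proof -
    have "card {i. \<bar>x $ i\<bar> \<noteq> 1} < k" using x by (simp add: skeleton_def cube_def)
    then have "m \<le> card {i. \<bar>x $ i\<bar> = 1}" using compl [of "\<lambda>i. \<bar>x $ i\<bar> = 1"] k
      unfolding m_def by linarith
    also have "\<dots> \<le> card {i. 1 - \<bar>x $ i\<bar> \<le> 0}" by (intro card_mono) auto
    finally show ?thesis using \<tau>_le [of x 0] \<tau>_ge [of x] x skeleton_cube by force
  qed
  have \<tau>_corner: "\<tau> x < 1" if x: "x \<in> corners" for x
  proof -
    obtain w where w: "w \<in> odd_vertices" "x \<in> cube" "real CARD('n) - 2 \<le> w \<bullet> x" using x by (auto simp: corners_def)
    have sv: "w \<in> sign_vectors" by (rule odd_vertices_sign [OF w(1)])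
    have "real (card {i. x $ i = 0}) = (\<Sum>i\<in>{i. x $ i = 0}. 1 - w $ i * x $ i)" by simp
    also have "\<dots> \<le> (\<Sum>i\<in>UNIV. 1 - w $ i * x $ i)"
      using sign_mult_le [OF sv w(2)] by (intro sum_mono2) auto
    \<comment> \<open>Each vanishing coordinate contributes \<open>1\<close> to the sum that defines the corner, so there are at most two.\<close>
    also have "\<dots> \<le> 2" using w(3) by (simp add: inner_cart sum_subtractf)
    finally have "card {i. x $ i = 0} < k" using k by linarith
    then have m: "m \<le> card {i. x $ i \<noteq> 0}" using compl [of "\<lambda>i. x $ i = 0"] k unfolding m_def by linarith
    obtain A where A: "A \<subseteq> {i. x $ i \<noteq> 0}" "card A = m" using m obtain_subset_with_card_n by blast
    define c where "c = Max ((\<lambda>i. 1 - \<bar>x $ i\<bar>) ` A)"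
    have "A \<noteq> {}" using A \<open>0 < m\<close> by auto
    then have "c < 1" using A(1) unfolding c_def by (subst Max_less_iff) auto
    have "card A \<le> card {i. 1 - \<bar>x $ i\<bar> \<le> c}"
      unfolding c_def by (intro card_mono) auto
    then show ?thesis using \<tau>_le [of x c] A(2) \<open>c < 1\<close> by simp
  qed
  define r :: "real ^ 'n \<Rightarrow> real ^ 'n" where "r x = (\<chi> i. max (-1) (min 1 (x $ i / (1 - \<tau> x))))" for x
  have cube: "x \<in> cube" and \<tau>: "0 \<le> \<tau> x" "\<tau> x < 1" if "x \<in> skeleton k \<union> corners" for x
  proof -
    show "x \<in> cube" using that skeleton_cube by (auto simp: corners_def)
    then show "0 \<le> \<tau> x" "\<tau> x < 1" using that \<tau>_ge \<tau>_skeleton \<tau>_corner by auto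
  qed
  have r_skeleton: "r x \<in> skeleton k" if x: "x \<in> skeleton k \<union> corners" for x
  proof -
    obtain A where A: "card A = m" "\<forall>i\<in>A. 1 - \<bar>x $ i\<bar> \<le> \<tau> x" using \<tau>_set by blast
    have "\<bar>r x $ i\<bar> = 1" if "i \<in> A" for i
    proof -
      have "1 - \<tau> x \<le> \<bar>x $ i\<bar>" using A that by fastforce
      then have "1 \<le> \<bar>x $ i / (1 - \<tau> x)\<bar>" using \<tau> [OF x] by (simp add: abs_divide)
      then have "\<bar>max (-1) (min 1 (x $ i / (1 - \<tau> x)))\<bar> = 1" by linarith
      then show ?thesis by (simp add: r_def)
    qed
    then have "m \<le> card {i. \<bar>r x $ i\<bar> = 1}" unfolding A(1) [symmetric] by (intro card_mono) auto
    then have "card {i. \<bar>r x $ i\<bar> \<noteq> 1} < k" using compl [of "\<lambda>i. \<bar>r x $ i\<bar> = 1"] k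
      unfolding m_def by linarith
    moreover have "\<bar>r x $ i\<bar> \<le> 1" for i by (simp add: r_def abs_le_iff)
    ultimately show ?thesis by (simp add: skeleton_def cube_def)
  qed
  have r_fix: "r x = x" if x: "x \<in> skeleton k" for x
  proof -
    have "\<bar>x $ i\<bar> \<le> 1" for i using x by (simp add: skeleton_def cube_def)
    then have "max (-1) (min 1 (x $ i)) = x $ i" for i by (simp add: abs_le_iff)
    then show ?thesis using \<tau>_skeleton [OF x] by (simp add: r_def vec_eq_iff)
  qed
  show ?thesis
  proof (rule homotopy_equivalent_linear_retract)
    show "continuous_on (skeleton k \<union> corners) r"
      unfolding r_def
      by (intro continuous_on_vec_lambda continuous_on_max continuous_on_min continuous_intros cont_\<tau>)
        (use \<tau>(2) in force)
    show "r ` (skeleton k \<union> corners) \<subseteq> skeleton k" using r_skeleton by blast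
    show "closed_segment x (r x) \<subseteq> skeleton k \<union> corners" if x: "x \<in> skeleton k \<union> corners" for x
    proof (cases "x \<in> skeleton k")
      case True
      then show ?thesis using r_fix by simp
    next
      case False
      then obtain w where w: "w \<in> odd_vertices" "real CARD('n) - 2 \<le> w \<bullet> x" using x by (auto simp: corners_def)
      have sv: "w \<in> sign_vectors" by (rule odd_vertices_sign [OF w(1)])
      have wr: "w $ i * r x $ i = max (-1) (min 1 (w $ i * x $ i / (1 - \<tau> x)))" for i
      proof -
        have odd: "- max (-1) (min 1 z) = max (-1) (min 1 (- z))" for z :: real by linarith
        have "w $ i = 1 \<or> w $ i = -1" using sv by (simp add: sign_vectors_def)
        then show ?thesis using odd [of "x $ i / (1 - \<tau> x)"] by (elim disjE) (simp_all add: r_def)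
      qed
      have sum: "(\<Sum>i\<in>UNIV. 1 - w $ i * z $ i) \<le> 2 \<longleftrightarrow> real CARD('n) - 2 \<le> w \<bullet> z" for z
        by (auto simp: inner_cart sum_subtractf)
      have "(\<Sum>i\<in>UNIV. 1 - w $ i * r x $ i) \<le> 2"
        unfolding wr
      proof (rule stretch_sum_le)
        show "w $ i * x $ i \<le> 1" for i by (rule sign_mult_le [OF sv cube [OF x]])
        show "(\<Sum>i\<in>UNIV. 1 - w $ i * x $ i) \<le> 2" using sum w(2) by blast
      qed (use \<tau> [OF x] in auto)
      then have "real CARD('n) - 2 \<le> w \<bullet> r x" using sum by blast
      then have "closed_segment x (r x) \<subseteq> corners"
        using r_skeleton [OF x] skeleton_cube by (intro closed_segment_corners [OF w(1) cube [OF x] _ w(2)]) auto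
      then show ?thesis by blast
    qed
  qed (use r_fix in auto)
qed

theorem theorem3p3p2:
  fixes k :: nat
  assumes "CARD('n::finite) \<ge> 4"
    and "3 \<le> k" and "k \<le> CARD('n)"
  shows "(\<forall>p :: int. p \<noteq> int k - 1 \<longrightarrow>
            trivial_group (reduced_homology_group p (half_cube_complex k :: (real ^ 'n) topology)))
       \<and> free_abelian (reduced_homology_group (int k - 1) (half_cube_complex k :: (real ^ 'n) topology))"
proof -
  let ?X = "half_cube_complex k :: (real ^ 'n) topology"
  let ?Q = "top_of_set (cell_union (cells_below k)) :: (real ^ 'n) topology"
  have "?X homotopy_equivalent_space top_of_set (skeleton k \<union> corners :: (real ^ 'n) set)"
    unfolding half_cube_complex_def union_cells_without [OF assms(2,3)]
    by (subst homotopy_equivalent_space_sym) (rule homotopy_equivalent_cut_corners)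
  also have "top_of_set (skeleton k \<union> corners :: (real ^ 'n) set) homotopy_equivalent_space ?Q"
    unfolding cell_union_cells_below by (rule homotopy_equivalent_skeleton [OF assms(2,3)])
  finally have he: "?X homotopy_equivalent_space ?Q" .
  then have iso: "reduced_homology_group p ?X \<cong> reduced_homology_group p ?Q" for p
    by (rule homotopy_equivalent_space_imp_isomorphic_reduced_homology_groups)
  have "trivial_group (reduced_homology_group p ?X)" if "p \<noteq> int k - 1" for p
  proof -
    have "trivial_group (reduced_homology_group p ?Q)"
    proof (cases "p < int k - 1")
      case True
      then show ?thesis using assms(2) by (intro trivial_reduced_homology_skeleton_below) auto
    next
      case False
      then have "int k \<le> p" "p \<noteq> 0" using that assms(2) by auto
      then show ?thesis by (simp add: un_reduced_homology_group trivial_homology_skeleton_above)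
    qed
    then show ?thesis using isomorphic_group_triviality [OF iso [of p]] by simp
  qed
  moreover have "free_abelian (reduced_homology_group (int k - 1) ?X)"
  proof (rule free_abelian_of_finitely_free)
    obtain j where j: "k = Suc j" "j \<noteq> 0" using assms(2) by (cases k) auto
    have "finitely_free (reduced_homology_group (int k - 1) ?Q)"
      using finitely_free_homology_skeleton [OF j(2), where 'n = 'n] j
      by (simp add: un_reduced_homology_group)
    then show "finitely_free (reduced_homology_group (int k - 1) ?X)"
      using iso by (rule finitely_free_iso)
    show "comm_group (reduced_homology_group (int k - 1) ?X)"
      using assms(2) by (simp add: un_reduced_homology_group abelian_homology_group)
  qed
  ultimately show ?thesis by blast
qed

end
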